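(* Consider the system $$x_2(t)=f_2(t,d(t),T_{r_2-\tau(t)}(t-\tau(t))x_2,u(t),v_2(t)),\qquad Y_2(t)=H_2(t,T_{r_2-\tau(t)}(t-\tau(t))x_2),\qquad(S2)$$ with $x_2(t)\in\mathbb{R}^{n_2}$, $Y_2(t)\in S_2$, $(u(t),v_2(t))\in U\times S_1$, $d(t)\in D$, $t\ge0$, under the standing hypotheses on $\tau,f_2,H_2$ given in the context. Suppose that there exist a functional $V:\mathbb{R}^+\times L^\infty([-r_2,0];\mathbb{R}^{n_2})\to\mathbb{R}^+$, functions $a_2\in K_\infty$, $\zeta,\zeta^u\in N$, $\beta,\delta_2,\delta_2^u\in K^+$ and a continuous positive definite function $\rho:\mathbb{R}^+\to\mathbb{R}^+$ such that $$V(t,x_2)\le a_2(\beta(t)\|x_2\|_{r_2}),\quad\forall(t,x_2)\in\mathbb{R}^+\times L^\infty([-r_2,0];\mathbb{R}^{n_2}),$$ $$V(t+h,G_h(t,x_2;d,u,v_2))\le\max\Big\{\sigma(V(t,x_2),h),\sup_{t\le s\le t+h}\zeta(\delta_2(s)|v_2(s)|),\sup_{t\le s\le t+h}\zeta^u(\delta_2^u(s)|u(s)|)\Big\}$$ for all $(t,x_2,u,v_2,d)\in\mathbb{R}^+\times L^\infty([-r_2,0];\mathbb{R}^{n_2})\times L^\infty_{loc}(\mathbb{R}^+;U)\times L^\infty_{loc}(\mathbb{R}^+;S_1)\times L^\infty_{loc}(\mathbb{R}^+;D)$ and $h\in(0,g(t)]$, where $G_h(t,x_2;d,u,v_2)$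 is the function on $[-r_2,0]$ $$G_h(t,x_2;d,u,v_2)(\theta)=\begin{cases}x_2(h+\theta),&\theta\in[-r_2,-h],\\ f_2(s,d(s),T_{r_2-\tau(s)}(s-t-\tau(s))x_2,u(s),v_2(s))\ \text{with } s=t+h+\theta,&\theta\in(-h,0],\end{cases}$$ $$g(t)=\min\Big\{1,\min_{t\le s\le t+1}\tau(s)\Big\},$$ and $\sigma\in KL$ is the function that satisfies $\frac{\partial}{\partial t}\sigma(s,t)=-\rho(\sigma(s,t))$ for all $t,s\ge0$ and $\sigma(s,0)=s$ for all $s\ge0$. Moreover, suppose that there exist functions $a_1,p\in K_\infty$, $\mu\in K^+$ and a constant $R\ge0$ such that one of the following inequalities holds: $$\text{(A)}\quad a_1\big(|H_2(t,T_{r_2-\tau(t)}(-\tau(t))x_2)|\big)\le V(t,x_2),\quad\forall(t,x_2)\in\mathbb{R}^+\times L^\infty([-r_2,0];\mathbb{R}^{n_2}),$$ $$\text{or (B)}\quad p(\mu(t)|x_2(0)|)\le V(t,x_2)+R,\quad\forall(t,x_2)\in\mathbb{R}^+\times L^\infty([-r_2,0];\mathbb{R}^{n_2}).$$ Then: (i) If (A) holds then there exists $\sigma_2\in KL$ such that, with $\beta_2(t)\equiv\beta(t)$, $\gamma_2(s):=a_1^{-1}(\zeta(s))$, $\gamma_2^u(s):=a_1^{-1}(\zeta^u(s))$, the estimate $$|H_2(t,T_{r_2-\tau(t)}(t-\tau(t))x_2)|\le\sigma_2(\beta_2(t_0)\|x_{20}\|_{r_2},t-t_0)+\sup_{t_0\le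 s\le t}\gamma_2(\delta_2(s)|v_2(s)|)+\sup_{t_0\le s\le t}\gamma_2^u(\delta_2^u(s)|u(s)|)$$ holds for all $(t_0,x_{20},(v_2,u,d))\in\mathbb{R}^+\times L^\infty([-r_2,0];\mathbb{R}^{n_2})\times L^\infty_{loc}(\mathbb{R}^+;S_1\times U\times D)$ and $t\ge t_0$ for the solution $x_2(t)$ of (S2) with initial condition $T_{r_2}(t_0)x_2=x_{20}$ corresponding to inputs $(v_2,u,d)$. (ii) If (B) holds and $\delta_2(t)\equiv1$ then for every $\phi\in K^+$ there exist functions $\mu_2,c_2\in K^+$, $g_2,p_2,p_2^u\in N$ such that $$\phi(t)\|T_{r_2}(t)x_2\|_{r_2}\le\max\Big\{\mu_2(t-t_0),c_2(t_0),g_2(\|x_{20}\|_{r_2}),\sup_{t_0\le s\le t}p_2(|v_2(s)|),\sup_{t_0\le s\le t}p_2^u(\delta_2^u(s)|u(s)|)\Big\}$$ for all $(t_0,x_{20},(v_2,u,d))\in\mathbb{R}^+\times L^\infty([-r_2,0];\mathbb{R}^{n_2})\times L^\infty_{loc}(\mathbb{R}^+;S_1\times U\times D)$ and $t\ge t_0$ for the solution $x_2(t)$ of (S2) with $T_{r_2}(t_0)x_2=x_{20}$ corresponding to inputs $(v_2,u,d)$. Moreover, if $\phi\in K^+$ is bounded and there exists a constant $L>0$ such that $\beta(t)+\frac{1}{\mu(t)}\le L$ for all $t\ge0$, then the function $c_2\in K^+$ can be taken bounded.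
   Context: Notation. $\mathbb{R}^+=[0,+\infty)$; $|x|$ is the Euclidean norm. $L^\infty(I;\Omega)$ (resp. $L^\infty_{loc}(I;\Omega)$) is the set of measurable and bounded (resp. locally bounded) functions $I\to\Omega$, as genuine functions with pointwise suprema (no identification a.e.). $\|x\|_r:=\sup_{\theta\in[-r,0]}|x(\theta)|$. $T_r(t)x$ is the function $\theta\mapsto x(t+\theta)$, $\theta\in[-r,0]$; in particular, for $x_2\in L^\infty([-r_2,0];\mathbb{R}^{n_2})$, $T_{r_2-\tau(t)}(-\tau(t))x_2$ is $\theta\mapsto x_2(\theta-\tau(t))$, $\theta\in[-r_2+\tau(t),0]$. $K^+$: positive continuous functions on $\mathbb{R}^+$. $\rho:\mathbb{R}^+\to\mathbb{R}^+$ is positive definite if $\rho(0)=0$ and $\rho(s)>0$ for $s>0$. $N$: non-decreasing $\rho:\mathbb{R}^+\to\mathbb{R}^+$ with $\rho(0)=0$. $K$: continuous, increasing, positive definite functions. $K_\infty$: $\rho\in K$ with $\lim_{s\to+\infty}\rho(s)=+\infty$. $KL$: continuous $\sigma:\mathbb{R}^+\times\mathbb{R}^+\to\mathbb{R}^+$ with $\sigma(\cdot,t)\in K$ for each $t\ge0$ and $\sigma(s,\cdot)$ non-increasing with $\lim_{t\to+\infty}\sigma(s,t)=0$ for each $s\ge0$. Standing hypotheses. $r_2\ge0$; $D\subseteq\mathbb{R}^l$ non-empty; $U\subseteq\mathbb{R}^m$, $S_1\subseteq\mathbb{R}^{k_1}$, $S_2\subseteq\mathbb{R}^{k_2}$ each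 containing $0$; $f_2:\bigcup_{t\ge0}\{t\}\times D\times L^\infty([-r_2+\tau(t),0];\mathbb{R}^{n_2})\times U\times S_1\to\mathbb{R}^{n_2}$ is locally bounded, and: - $\tau:\mathbb{R}^+\to(0,+\infty)$ is continuous with $\sup_{t\ge0}\tau(t)\le r_2$. - For every $v\in L^\infty_{loc}(\mathbb{R}^+;S_1)$, $d\in L^\infty_{loc}(\mathbb{R}^+;D)$, $u\in L^\infty_{loc}(\mathbb{R}^+;U)$ and $x_2\in L^\infty_{loc}([-r_2,+\infty);\mathbb{R}^{n_2})$ the mapping $t\mapsto f_2(t,d(t),T_{r_2-\tau(t)}(t-\tau(t))x_2,u(t),v(t))$ is measurable. - $H_2:\bigcup_{t\ge0}\{t\}\times L^\infty([-r_2+\tau(t),0];\mathbb{R}^{n_2})\to S_2$ is continuous (i.e. $(t,x_2)\mapsto H_2(t,T_{r_2-\tau(t)}(-\tau(t))x_2)$ is continuous on $\mathbb{R}^+\times L^\infty([-r_2,0];\mathbb{R}^{n_2})$), maps bounded sets into bounded sets, and $H_2(t,0)=0$ for all $t\ge0$; moreover, for every $x_2\in L^\infty_{loc}([-r_2,+\infty);\mathbb{R}^{n_2})$ the mapping $t\mapsto H_2(t,T_{r_2-\tau(t)}(t-\tau(t))x_2)$ is measurable. - There exist $\tilde\beta\in K^+$, $\tilde a\in K_\infty$ such that $|f_2(t,d,T_{r_2-\tau(t)}(-\tau(t))x_2,u,v)|\le\tilde a(\tilde\beta(t)\sup_{\theta\in[-r_2,-\tau(t)]}|x_2(\theta)|)+\tilde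 a(\tilde\beta(t)|u|)+\tilde a(\tilde\beta(t)|v|)$ for all $(t,x_2,u,v,d)\in\mathbb{R}^+\times L^\infty([-r_2,0];\mathbb{R}^{n_2})\times U\times S_1\times D$. Solutions. Under these hypotheses, for each $(t_0,x_{20})$ and measurable, locally bounded inputs $(v_2,u,d)$ there is a unique measurable and locally bounded $x_2:[t_0-r_2,+\infty)\to\mathbb{R}^{n_2}$ with $T_{r_2}(t_0)x_2=x_{20}$ satisfying the difference equation for all $t>t_0$; this is the solution of (S2). *)

theory Defs
  imports "HOL-Analysis.Analysis"
begin

section \<open>Comparison functions\<close>

text \<open>A function on the half-line is a total function \<^typ>\<open>real \<Rightarrow> real\<close> of which only the
  values on \<^term>\<open>{0::real..}\<close> are constrained.\<close>

definition Kplus :: "(real \<Rightarrow> real) set" where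
  "Kplus = {\<phi>. continuous_on {0..} \<phi> \<and> (\<forall>t\<ge>0. \<phi> t > 0)}"

definition posdef :: "(real \<Rightarrow> real) \<Rightarrow> bool" where
  "posdef \<rho> \<longleftrightarrow> \<rho> 0 = 0 \<and> (\<forall>s>0. \<rho> s > 0)"

definition classN :: "(real \<Rightarrow> real) set" where
  "classN = {\<rho>. mono_on {0..} \<rho> \<and> \<rho> 0 = 0}"

definition classK :: "(real \<Rightarrow> real) set" where
  "classK = {\<rho>. continuous_on {0..} \<rho> \<and> strict_mono_on {0..} \<rho> \<and> posdef \<rho>}"

definition Kinf :: "(real \<Rightarrow> real) set" where
  "Kinf = {\<rho> \<in> classK. filterlim \<rho> at_top at_top}"

definition KL :: "(real \<Rightarrow> real \<Rightarrow> real) set" where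
  "KL = {\<sigma>. continuous_on ({0..} \<times> {0..}) (\<lambda>(s, t). \<sigma> s t) \<and>
      (\<forall>t\<ge>0. (\<lambda>s. \<sigma> s t) \<in> classK) \<and>
      (\<forall>s\<ge>0. antimono_on {0..} (\<sigma> s) \<and> (\<sigma> s \<longlongrightarrow> 0) at_top)}"


section \<open>Spaces of bounded and locally bounded functions\<close>

text \<open>A function with domain \<^term>\<open>I :: real set\<close> is an extensional one (equal to
  \<^term>\<open>undefined\<close> off \<^term>\<open>I\<close>), so that two of them are equal iff they agree at every point of
  \<^term>\<open>I\<close>. Measurability is Lebesgue measurability; nothing is identified almost everywhere.\<close>

definition Linf :: "real set \<Rightarrow> 'a::euclidean_space set \<Rightarrow> (real \<Rightarrow> 'a) set" where
  "Linf I \<Omega> = {x \<in> I \<rightarrow>\<^sub>E \<Omega>. x \<in> borel_measurable (lebesgue_on I) \<and> bounded (x ` I)}"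

definition Linf_loc :: "real set \<Rightarrow> 'a::euclidean_space set \<Rightarrow> (real \<Rightarrow> 'a) set" where
  "Linf_loc I \<Omega> = {x \<in> I \<rightarrow>\<^sub>E \<Omega>. x \<in> borel_measurable (lebesgue_on I) \<and>
      (\<forall>C. compact C \<and> C \<subseteq> I \<longrightarrow> bounded (x ` C))}"

definition supnorm :: "real \<Rightarrow> (real \<Rightarrow> 'a::euclidean_space) \<Rightarrow> real" where
  "supnorm r x = (SUP \<theta>\<in>{-r..0}. norm (x \<theta>))"

text \<open>The topology of uniform convergence on \<^term>\<open>Linf {-r..0} UNIV\<close>; the metric of
  \<^const>\<open>funspace\<close> is the supremum of the pointwise distances.\<close>

definition Linf_topology :: "real \<Rightarrow> (real \<Rightarrow> 'a::euclidean_space) topology" where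
  "Linf_topology r = mtopology_of (submetric (funspace {-r..0} euclidean_metric) (Linf {-r..0} UNIV))"

definition locally_bounded_map :: "'a topology \<Rightarrow> ('a \<Rightarrow> 'b::metric_space) \<Rightarrow> bool" where
  "locally_bounded_map X F \<longleftrightarrow> (\<forall>p\<in>topspace X. \<exists>W. openin X W \<and> p \<in> W \<and> bounded (F ` W))"

text \<open>The history operator \<open>T\<^sub>r(t)\<close>.\<close>

definition hist :: "real \<Rightarrow> real \<Rightarrow> (real \<Rightarrow> 'a) \<Rightarrow> (real \<Rightarrow> 'a)" where
  "hist r t x = restrict (\<lambda>\<theta>. x (t + \<theta>)) {-r..0}"


section \<open>The difference system\<close>

text \<open>At time \<^term>\<open>t\<close>, the third argument of \<open>f\<^sub>2\<close> and the second argument of \<open>H\<^sub>2\<close> are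
  histories on \<open>[-r\<^sub>2 + \<tau>(t), 0]\<close>. Continuity of \<open>H\<^sub>2\<close> and local boundedness of \<open>f\<^sub>2\<close>, whose
  domains vary with \<^term>\<open>t\<close>, are expressed through the fixed space of functions on
  \<open>[-r\<^sub>2, 0]\<close>.\<close>

locale difference_system =
  fixes r2 :: real
    and D :: "(real ^ 'l) set"
    and U :: "(real ^ 'm) set"
    and S1 :: "(real ^ 'k1) set"
    and S2 :: "(real ^ 'k2) set"
    and \<tau> :: "real \<Rightarrow> real"
    and f2 :: "real \<Rightarrow> real ^ 'l \<Rightarrow> (real \<Rightarrow> real ^ 'n2) \<Rightarrow> real ^ 'm \<Rightarrow> real ^ 'k1 \<Rightarrow> real ^ 'n2"
    and H2 :: "real \<Rightarrow> (real \<Rightarrow> real ^ 'n2) \<Rightarrow> real ^ 'k2"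
  assumes r2_nonneg: "r2 \<ge> 0"
    and D_nonempty: "D \<noteq> {}"
    and zero_mem: "0 \<in> U" "0 \<in> S1" "0 \<in> S2"
    and tau_cont: "continuous_on {0..} \<tau>"
    and tau_bounds: "\<And>t. t \<ge> 0 \<Longrightarrow> 0 < \<tau> t \<and> \<tau> t \<le> r2"
    and f2_locally_bounded:
      "locally_bounded_map
         (prod_topology (top_of_set {0..}) (prod_topology (top_of_set D)
            (prod_topology (Linf_topology r2) (prod_topology (top_of_set U) (top_of_set S1)))))
         (\<lambda>(t, d, x, u, v). f2 t d (hist (r2 - \<tau> t) (- \<tau> t) x) u v)"
    and f2_measurable:
      "\<And>v d u x. \<lbrakk>v \<in> Linf_loc {0..} S1; d \<in> Linf_loc {0..} D; u \<in> Linf_loc {0..} U;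
          x \<in> Linf_loc {-r2..} UNIV\<rbrakk> \<Longrightarrow>
        (\<lambda>t. f2 t (d t) (hist (r2 - \<tau> t) (t - \<tau> t) x) (u t) (v t))
          \<in> borel_measurable (lebesgue_on {0..})"
    and H2_range: "\<And>t y. \<lbrakk>t \<ge> 0; y \<in> Linf {-(r2 - \<tau> t)..0} UNIV\<rbrakk> \<Longrightarrow> H2 t y \<in> S2"
    and H2_cont:
      "continuous_map (prod_topology (top_of_set {0..}) (Linf_topology r2)) (top_of_set S2)
         (\<lambda>(t, x). H2 t (hist (r2 - \<tau> t) (- \<tau> t) x))"
    and H2_bounded:
      "\<And>a b. bounded {H2 t y | t y. 0 \<le> t \<and> t \<le> a \<and> y \<in> Linf {-(r2 - \<tau> t)..0} UNIV \<and>
          supnorm (r2 - \<tau> t) y \<le> b}"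
    and H2_zero: "\<And>t. t \<ge> 0 \<Longrightarrow> H2 t (restrict (\<lambda>\<theta>. 0) {-(r2 - \<tau> t)..0}) = 0"
    and H2_measurable:
      "\<And>x. x \<in> Linf_loc {-r2..} UNIV \<Longrightarrow>
        (\<lambda>t. H2 t (hist (r2 - \<tau> t) (t - \<tau> t) x)) \<in> borel_measurable (lebesgue_on {0..})"
    and f2_growth:
      "\<exists>b\<in>Kplus. \<exists>a\<in>Kinf. \<forall>t\<ge>0. \<forall>x\<in>Linf {-r2..0} UNIV. \<forall>u\<in>U. \<forall>v\<in>S1. \<forall>d\<in>D.
        norm (f2 t d (hist (r2 - \<tau> t) (- \<tau> t) x) u v)
          \<le> a (b t * (SUP \<theta>\<in>{-r2..- \<tau> t}. norm (x \<theta>))) + a (b t * norm u) + a (b t * norm v)"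

definition is_solution ::
  "real \<Rightarrow> (real \<Rightarrow> real) \<Rightarrow>
   (real \<Rightarrow> real ^ 'l \<Rightarrow> (real \<Rightarrow> real ^ 'n2) \<Rightarrow> real ^ 'm \<Rightarrow> real ^ 'k1 \<Rightarrow> real ^ 'n2) \<Rightarrow>
   real \<Rightarrow> (real \<Rightarrow> real ^ 'n2) \<Rightarrow> (real \<Rightarrow> real ^ 'k1) \<Rightarrow> (real \<Rightarrow> real ^ 'm) \<Rightarrow> (real \<Rightarrow> real ^ 'l) \<Rightarrow>
   (real \<Rightarrow> real ^ 'n2) \<Rightarrow> bool" where
  "is_solution r2 \<tau> f2 t0 x20 v2 u d x2 \<longleftrightarrow>
     x2 \<in> Linf_loc {t0 - r2..} UNIV \<and> hist r2 t0 x2 = x20 \<and>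
     (\<forall>t>t0. x2 t = f2 t (d t) (hist (r2 - \<tau> t) (t - \<tau> t) x2) (u t) (v2 t))"

definition G_step ::
  "real \<Rightarrow> (real \<Rightarrow> real) \<Rightarrow>
   (real \<Rightarrow> real ^ 'l \<Rightarrow> (real \<Rightarrow> real ^ 'n2) \<Rightarrow> real ^ 'm \<Rightarrow> real ^ 'k1 \<Rightarrow> real ^ 'n2) \<Rightarrow>
   real \<Rightarrow> real \<Rightarrow> (real \<Rightarrow> real ^ 'n2) \<Rightarrow> (real \<Rightarrow> real ^ 'l) \<Rightarrow> (real \<Rightarrow> real ^ 'm) \<Rightarrow> (real \<Rightarrow> real ^ 'k1) \<Rightarrow>
   (real \<Rightarrow> real ^ 'n2)" where
  "G_step r2 \<tau> f2 h t x2 d u v2 = restrict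
     (\<lambda>\<theta>. if \<theta> \<le> - h then x2 (h + \<theta>)
          else let s = t + h + \<theta>
               in f2 s (d s) (hist (r2 - \<tau> s) (s - t - \<tau> s) x2) (u s) (v2 s))
     {-r2..0}"

text \<open>The infimum below is attained when \<^term>\<open>\<tau>\<close> is continuous.\<close>

definition g_step :: "(real \<Rightarrow> real) \<Rightarrow> real \<Rightarrow> real" where
  "g_step \<tau> t = min 1 (INF s\<in>{t..t + 1}. \<tau> s)"

end

theory Submission
  imports Defs
begin

text \<open>The trajectory at time \<open>t + h\<close> is obtained from its history at time \<open>t\<close> by one application of
  \<open>G\<^sub>h\<close> as long as \<open>h \<le> g(t)\<close>, and \<open>g\<close> is bounded below on compact time intervals, so the
  inequality for \<open>V\<close> can be iterated finitely many times. Because \<open>\<sigma>\<close> is a semigroup in its second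
  argument and \<open>\<sigma>(s, h) \<le> s\<close>, the iteration gives
  \<open>V(t) \<le> max {\<sigma>(V(t\<^sub>0), t - t\<^sub>0), sup \<zeta>, sup \<zeta>\<^sup>u}\<close> along solutions. Part (i) follows by applying
  \<open>a\<^sub>1\<close> inverse. For part (ii), a non-decreasing continuous \<open>M\<close> dominates \<open>1\<close>, \<open>\<phi>\<close>, \<open>\<beta>\<close> and \<open>1/\<mu>\<close>;
  all products are split by \<open>x y \<le> max (x\<^sup>2) (y\<^sup>2)\<close>, and
  \<open>M(t) \<le> max (M(2 t\<^sub>0)) (M(2 (t - t\<^sub>0)))\<close> separates \<open>t\<^sub>0\<close> from \<open>t - t\<^sub>0\<close>.\<close>


section \<open>Class \<open>Kinf\<close> functions and their inverses\<close>

lemma KinfD: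
  assumes "a \<in> Kinf"
  shows "continuous_on {0..} a" "strict_mono_on {0..} a" "mono_on {0..} a" "a 0 = 0"
    "\<And>x. 0 \<le> x \<Longrightarrow> 0 \<le> a x" "filterlim a at_top at_top"
proof -
  show *: "continuous_on {0..} a" "strict_mono_on {0..} a" "a 0 = 0" "filterlim a at_top at_top"
    using assms by (auto simp: Kinf_def classK_def posdef_def)
  show "mono_on {0..} a"
    using * strict_mono_on_imp_mono_on by blast
  show "0 \<le> a x" if "0 \<le> x" for x
    using assms that by (cases "x = 0") (auto simp: Kinf_def classK_def posdef_def less_imp_le)
qed

text \<open>Surjectivity is the intermediate value theorem between 0, where \<open>a\<close>
  vanishes, and a point beyond which \<open>a\<close> exceeds the target value.\<close>

lemma Kinf_bij:
  assumes "a \<in> Kinf"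
  shows "bij_betw a {0..} {0..}"
proof -
  have "a ` {0..} = {0..}"
  proof
    show "a ` {0..} \<subseteq> {0..}"
      using KinfD(5)[OF assms] by auto
    show "{0..} \<subseteq> a ` {0..}"
    proof
      fix y :: real assume y: "y \<in> {0..}"
      have "eventually (\<lambda>x. y \<le> a x) at_top"
        using KinfD(6)[OF assms] by (simp add: filterlim_at_top)
      then obtain b where b: "\<And>x. b \<le> x \<Longrightarrow> y \<le> a x"
        by (auto simp: eventually_at_top_linorder)
      have "\<exists>x\<ge>0. x \<le> max 0 b \<and> a x = y"
        by (rule IVT') (use y b KinfD[OF assms] in \<open>auto intro: continuous_on_subset\<close>)
      then show "y \<in> a ` {0..}" by force
    qed
  qed
  then show ?thesis
    using KinfD(2)[OF assms] by (simp add: bij_betw_def strict_mono_on_imp_inj_on)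
qed

text \<open>The inverse is written with \<open>the_inv_into\<close> because this is how the inverses
  of \<open>a1\<close> and \<open>p\<close> enter the final estimates. Monotonicity and growth of
  \<open>b\<close> are read off from those of \<open>a\<close>.\<close>

lemma Kinf_inverse:
  fixes a :: "real \<Rightarrow> real"
  assumes "a \<in> Kinf"
  defines "b \<equiv> the_inv_into {0..} a"
  shows "b \<in> Kinf" "\<And>y. 0 \<le> y \<Longrightarrow> a (b y) = y" "\<And>x. 0 \<le> x \<Longrightarrow> b (a x) = x"
proof -
  note D = KinfD[OF assms(1)]
  have inj: "inj_on a {0..}" and im: "a ` {0..} = {0..}"
    using Kinf_bij[OF assms(1)] by (auto simp: bij_betw_def)
  show ab: "a (b y) = y" if "0 \<le> y" for y
    unfolding b_def using that im inj by (intro f_the_inv_into_f) auto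
  show ba: "b (a x) = x" if "0 \<le> x" for x
    unfolding b_def using that inj by (intro the_inv_into_f_f) auto
  have b_nonneg: "0 \<le> b y" if "0 \<le> y" for y
    using the_inv_into_into[OF inj, of y "{0..}"] that im by (auto simp: b_def)
  have a_less: "a x < a y \<longleftrightarrow> x < y" if "0 \<le> x" "0 \<le> y" for x y
    using D(2) that strict_mono_on_less by fastforce
  have b_less: "b x < b y" if "0 \<le> x" "x < y" for x y
    using a_less[of "b x" "b y"] ab b_nonneg that by auto
  have b0: "b 0 = 0"
    using ba[of 0] D(4) by simp
  have b_pos: "0 < b y" if "0 < y" for y
    using b_less[of 0 y] b0 that by simp
  \<comment> \<open>Continued by the identity on the negative axis, \<open>b\<close> becomes a
    monotone surjection of the whole line; its image is then open, and a monotone map with open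
    image is continuous.\<close>
  define B where "B = (\<lambda>y. if 0 \<le> y then b y else y)"
  have "B ` UNIV = UNIV"
  proof -
    have "x \<in> range B" for x
    proof (cases "0 \<le> x")
      case True
      then have "x = B (a x)" using ba D(5) by (simp add: B_def)
      then show ?thesis by blast
    next
      case False
      then have "x = B x" by (simp add: B_def)
      then show ?thesis by blast
    qed
    then show ?thesis by auto
  qed
  moreover have "B x \<le> B y" if "x \<le> y" for x y
    using that b_less[of x y] b_nonneg[of y] by (auto simp: B_def le_less)
  ultimately have "continuous_on UNIV B"
    by (intro continuous_onI_mono) auto
  then have "continuous_on {0..} B"
    by (rule continuous_on_subset) auto
  then have cont: "continuous_on {0..} b"
    by (rule continuous_on_eq) (auto simp: B_def)
  have "filterlim b at_top at_top"
    unfolding filterlim_at_top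
  proof
    fix Z :: real
    have "Z \<le> b y" if "a (max 0 Z) \<le> y" for y
    proof -
      have "0 \<le> y" using that D(5)[of "max 0 Z"] by linarith
      then have "\<not> b y < max 0 Z"
        using a_less[of "b y" "max 0 Z"] ab b_nonneg that by auto
      then show ?thesis by linarith
    qed
    then show "eventually (\<lambda>y. Z \<le> b y) at_top"
      using eventually_at_top_linorder by blast
  qed
  then show "b \<in> Kinf"
    using cont b0 b_pos b_less
    by (auto simp: Kinf_def classK_def posdef_def strict_mono_on_def)
qed

section \<open>Suprema under monotone maps, and monotone majorants\<close>

text \<open>Iterating the inequality for \<open>V\<close> bounds it by suprema of
  \<open>\<zeta>\<close> and \<open>\<zeta>u\<close>, whereas the final gains are compositions under
  the supremum. Only the outer function has to be continuous, so \<open>\<zeta>\<close> and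
  \<open>\<zeta>u\<close> may jump.\<close>

lemma mono_continuous_SUP:
  fixes k f :: "real \<Rightarrow> real"
  assumes k: "continuous_on {0..} k" "mono_on {0..} k"
    and S: "S \<noteq> {}" "bdd_above (f ` S)" "\<And>s. s \<in> S \<Longrightarrow> 0 \<le> f s"
  shows "k (SUP s\<in>S. f s) = (SUP s\<in>S. k (f s))"
proof -
  \<comment> \<open>Constant continuation to the left of 0 makes the map monotone and continuous on
    all reals, as the library rule for suprema demands.\<close>
  let ?k = "\<lambda>x. k (max 0 x)"
  have "mono ?k"
    by (rule monoI, rule mono_onD[OF k(2)]) auto
  moreover have "continuous_on UNIV ?k"
    by (rule continuous_on_compose2[OF k(1)]) (auto intro!: continuous_intros)
  then have "continuous (at_left (SUP s\<in>S. f s)) ?k"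
    by (metis UNIV_I continuous_on_eq_continuous_within continuous_within_subset subset_UNIV)
  ultimately have "?k (Sup (f ` S)) = (SUP y\<in>f ` S. ?k y)"
    using S by (intro continuous_at_Sup_mono) auto
  moreover have "0 \<le> (SUP s\<in>S. f s)"
  proof -
    obtain s where "s \<in> S" using S by auto
    then show ?thesis using S cSUP_upper2[OF S(2) \<open>s \<in> S\<close>, of 0] by auto
  qed
  ultimately have "k (SUP s\<in>S. f s) = (SUP y\<in>f ` S. ?k y)"
    by simp
  also have "\<dots> = (SUP s\<in>S. ?k (f s))"
    by (simp add: image_image)
  also have "\<dots> = (SUP s\<in>S. k (f s))"
    by (rule SUP_cong) (use S in auto)
  finally show ?thesis .
qed

text \<open>The witness is the running supremum of \<open>q\<close>. Its minimality among monotone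
  majorants gives the last clause: any uniform bound on \<open>q\<close> passes to \<open>M\<close>,
  which later yields the boundedness of \<open>c2\<close>.\<close>

lemma mono_Kplus_dominating:
  assumes q: "q \<in> Kplus"
  obtains M where "M \<in> Kplus" "mono_on {0..} M" "\<And>t. 0 \<le> t \<Longrightarrow> q t \<le> M t"
    "\<And>B t. \<forall>s\<ge>0. q s \<le> B \<Longrightarrow> 0 \<le> t \<Longrightarrow> M t \<le> B"
proof
  define M where "M = (\<lambda>t. SUP s\<in>{0..t}. q s)"
  have qc: "continuous_on {0..} q" and qpos: "\<And>t. 0 \<le> t \<Longrightarrow> 0 < q t"
    using q by (auto simp: Kplus_def)
  have bdd: "bdd_above (q ` {0..t})" for t
    by (intro bounded_imp_bdd_above compact_imp_bounded compact_continuous_image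
        continuous_on_subset[OF qc]) auto
  show le: "q t \<le> M t" if "0 \<le> t" for t
    unfolding M_def using that bdd by (intro cSUP_upper) auto
  show mono: "mono_on {0..} M"
    unfolding M_def by (intro mono_onI cSUP_subset_mono) (auto intro: bdd)
  have "continuous_on {0..} M"
    unfolding continuous_on_iff
  proof safe
    fix t e :: real assume t: "0 \<le> t" and e: "0 < e"
    then obtain d where d: "0 < d" "\<And>s. 0 \<le> s \<Longrightarrow> \<bar>s - t\<bar> < d \<Longrightarrow> \<bar>q s - q t\<bar> < e / 4"
      using qc[unfolded continuous_on_iff, rule_format, of t "e/4"]
      by (auto simp: dist_real_def)
    \<comment> \<open>A value of \<open>q\<close> attained after \<open>x\<close> exceeds
      \<open>q x\<close> by at most two deviations of e/4 from \<open>q t\<close>; values attained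
      up to \<open>x\<close> are already counted in \<open>M x\<close>.\<close>
    have step: "M y \<le> M x + e / 2"
      if "0 \<le> x" "x \<le> y" "\<bar>x - t\<bar> < d" "\<bar>y - t\<bar> < d" for x y
      unfolding M_def
    proof (rule cSUP_least)
      fix s assume s: "s \<in> {0..y}"
      show "q s \<le> (SUP s\<in>{0..x}. q s) + e / 2"
      proof (cases "s \<le> x")
        case True
        then show ?thesis
          using le[of s] mono_onD[OF mono, of s x] s that e by (simp add: M_def)
      next
        case False
        then have "\<bar>q s - q t\<bar> < e / 4" "\<bar>q x - q t\<bar> < e / 4"
          using d s that by auto
        then have "q s \<le> q x + e / 2" by linarith
        then show ?thesis using le[of x] that by (simp add: M_def)
      qed
    qed (use that in auto)
    show "\<exists>d>0. \<forall>x'\<in>{0..}. dist x' t < d \<longrightarrow> dist (M x') (M t) < e"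
    proof (intro exI conjI ballI impI)
      fix x assume x: "x \<in> {0..}" "dist x t < d"
      show "dist (M x) (M t) < e"
      proof (cases x t rule: le_cases)
        case le
        then show ?thesis using step[of x t] mono_onD[OF mono, of x t] x t e d
          by (auto simp: dist_real_def)
      next
        case ge
        then show ?thesis using step[of t x] mono_onD[OF mono, of t x] x t e d
          by (auto simp: dist_real_def)
      qed
    qed (fact d)
  qed
  show "M t \<le> B" if "\<forall>s\<ge>0. q s \<le> B" "0 \<le> t" for B t
    unfolding M_def using that by (intro cSUP_least) auto
  show "M \<in> Kplus"
    using \<open>continuous_on {0..} M\<close> le qpos by (force simp: Kplus_def intro: less_le_trans)
qed

section \<open>\<open>KL\<close> functions and the flow of the decay equation\<close>

lemma KL_classK: "\<sigma> \<in> KL \<Longrightarrow> 0 \<le> t \<Longrightarrow> (\<lambda>s. \<sigma> s t) \<in> classK"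
  unfolding KL_def by blast

lemma KL_antimono: "\<sigma> \<in> KL \<Longrightarrow> 0 \<le> s \<Longrightarrow> 0 \<le> t \<Longrightarrow> t \<le> t' \<Longrightarrow> \<sigma> s t' \<le> \<sigma> s t"
proof -
  assume *: "\<sigma> \<in> KL" "0 \<le> s" "0 \<le> t" "t \<le> t'"
  then have "antimono_on {0..} (\<sigma> s)"
    unfolding KL_def by blast
  from monotone_onD[OF this, of t t'] show "\<sigma> s t' \<le> \<sigma> s t"
    using * by simp
qed

lemma KL_zero: "\<sigma> \<in> KL \<Longrightarrow> 0 \<le> t \<Longrightarrow> \<sigma> 0 t = 0"
  using KL_classK[of \<sigma> t] unfolding classK_def posdef_def by blast

lemma KL_pos: "\<sigma> \<in> KL \<Longrightarrow> 0 < s \<Longrightarrow> 0 \<le> t \<Longrightarrow> 0 < \<sigma> s t"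
  using KL_classK[of \<sigma> t] unfolding classK_def posdef_def by blast

lemma KL_nonneg: "\<sigma> \<in> KL \<Longrightarrow> 0 \<le> s \<Longrightarrow> 0 \<le> t \<Longrightarrow> 0 \<le> \<sigma> s t"
  using KL_pos[of \<sigma> s t] KL_zero[of \<sigma> t] by (cases "s = 0") auto

lemma KL_mono: "\<sigma> \<in> KL \<Longrightarrow> 0 \<le> s \<Longrightarrow> s \<le> s' \<Longrightarrow> 0 \<le> t \<Longrightarrow> \<sigma> s t \<le> \<sigma> s' t"
proof -
  assume *: "\<sigma> \<in> KL" "0 \<le> s" "s \<le> s'" "0 \<le> t"
  have "strict_mono_on {0..} (\<lambda>s. \<sigma> s t)"
    using KL_classK[OF *(1,4)] unfolding classK_def by blast
  then have "mono_on {0..} (\<lambda>s. \<sigma> s t)"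
    by (rule strict_mono_on_imp_mono_on)
  from mono_onD[OF this, of s s'] show "\<sigma> s t \<le> \<sigma> s' t"
    using * by simp
qed

text \<open>Along a positive solution of \<open>y' = -\<rho>(y)\<close> the primitive of \<open>1/\<rho>\<close> decreases at unit speed,
  hence two solutions with the same initial value coincide although \<open>\<rho>\<close> is merely continuous.\<close>

lemma autonomous_decay_unique:
  fixes \<rho> y z :: "real \<Rightarrow> real"
  assumes rho: "continuous_on {0..} \<rho>" "\<And>s. 0 < s \<Longrightarrow> 0 < \<rho> s"
    and h: "0 \<le> h"
    and y: "\<And>t. 0 \<le> t \<Longrightarrow> t \<le> h \<Longrightarrow> (y has_real_derivative - \<rho> (y t)) (at t within {0..h})"
      "\<And>t. 0 \<le> t \<Longrightarrow> t \<le> h \<Longrightarrow> 0 < y t"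
    and z: "\<And>t. 0 \<le> t \<Longrightarrow> t \<le> h \<Longrightarrow> (z has_real_derivative - \<rho> (z t)) (at t within {0..h})"
      "\<And>t. 0 \<le> t \<Longrightarrow> t \<le> h \<Longrightarrow> 0 < z t"
    and eq: "y 0 = z 0"
  shows "y h = z h"
proof -
  have cy: "continuous_on {0..h} y" and cz: "continuous_on {0..h} z"
    unfolding continuous_on_eq_continuous_within
    using DERIV_continuous[OF y(1)] DERIV_continuous[OF z(1)] by simp_all
  \<comment> \<open>Both trajectories are positive and compact, so their common minimum
    \<open>m\<close> is positive and 1/\<rho> is continuous on the range they sweep.\<close>
  define C where "C = y ` {0..h} \<union> z ` {0..h}"
  have C: "compact C" "C \<noteq> {}"
    using cy cz h unfolding C_def by (auto intro!: compact_Un compact_continuous_image)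
  obtain m where m: "m \<in> C" "\<And>w. w \<in> C \<Longrightarrow> m \<le> w"
    using compact_attains_inf[OF C] by blast
  obtain M where M: "\<And>w. w \<in> C \<Longrightarrow> w \<le> M"
    using compact_attains_sup[OF C] by blast
  have mM: "m \<in> y ` {0..h} \<union> z ` {0..h}"
    "\<And>w. w \<in> y ` {0..h} \<union> z ` {0..h} \<Longrightarrow> m \<le> w"
    "\<And>w. w \<in> y ` {0..h} \<union> z ` {0..h} \<Longrightarrow> w \<le> M"
    using m M by (simp_all add: C_def)
  have "0 < m" using mM(1) y(2) z(2) by auto
  define F where "F = (\<lambda>x. integral {m..x} (\<lambda>s. 1 / \<rho> s))"
  have cont: "continuous_on {m..M} (\<lambda>s. 1 / \<rho> s)"
  proof (intro continuous_intros continuous_on_subset[OF rho(1)])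
    show "{m..M} \<subseteq> {0..}"
      using \<open>0 < m\<close> by auto
    show "\<forall>s\<in>{m..M}. \<rho> s \<noteq> 0"
    proof
      fix s assume "s \<in> {m..M}"
      then have "0 < \<rho> s" using \<open>0 < m\<close> by (intro rho(2)) auto
      then show "\<rho> s \<noteq> 0" by simp
    qed
  qed
  have F: "(F has_real_derivative 1 / \<rho> x) (at x within {m..M})" if "x \<in> {m..M}" for x
    unfolding F_def by (rule integral_has_real_derivative[OF cont that])
  have chain: "((\<lambda>t. F (w t)) has_real_derivative -1) (at t within {0..h})"
    if t: "0 \<le> t" "t \<le> h" and w: "w = y \<or> w = z" for w t
  proof -
    have "w ` {0..h} \<subseteq> {m..M}"
      using mM(2,3) w by auto
    then have "(F has_real_derivative 1 / \<rho> (w t)) (at (w t) within w ` {0..h})"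
      using t image_subset_iff[of w "{0..h}" "{m..M}"] by (intro DERIV_subset[OF F]) auto
    moreover have "(w has_real_derivative - \<rho> (w t)) (at t within {0..h})"
      using w y(1) z(1) t by auto
    moreover have "0 < \<rho> (w t)"
      using w y(2) z(2) t rho(2) by auto
    ultimately show ?thesis
      using DERIV_image_chain[of F "1 / \<rho> (w t)" w t "{0..h}" "- \<rho> (w t)"] by (simp add: o_def)
  qed
  have "((\<lambda>t. F (y t) - F (z t)) has_real_derivative 0) (at t within {0..h})"
    if "t \<in> {0..h}" for t
    using DERIV_diff[OF chain[of t y] chain[of t z]] that by simp
  then obtain c where c: "\<forall>t\<in>{0..h}. F (y t) - F (z t) = c"
    using has_field_derivative_zero_constant[of "{0..h}"] by blast
  have Feq: "F (y h) = F (z h)"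
    using bspec[OF c, of 0] bspec[OF c, of h] eq h by simp
  \<comment> \<open>Strict growth of \<open>F\<close> makes it injective, which turns the equality
    of \<open>F (y h)\<close> and \<open>F (z h)\<close> into the claim.\<close>
  have F_less: "F x < F x'" if "x \<in> {m..M}" "x' \<in> {m..M}" "x < x'" for x x'
  proof -
    have cF: "continuous_on {m..M} F"
      unfolding continuous_on_eq_continuous_within using DERIV_continuous[OF F] by blast
    have dF: "(F has_derivative (*) (1 / \<rho> \<xi>)) (at \<xi>)" if "x < \<xi>" "\<xi> < x'" for \<xi>
    proof -
      have "m < \<xi>" "\<xi> < M"
        using that \<open>x \<in> {m..M}\<close> \<open>x' \<in> {m..M}\<close> by auto
      then have "(F has_real_derivative 1 / \<rho> \<xi>) (at \<xi>)"
        using F[of \<xi>] by (simp add: at_within_Icc_at)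
      then show ?thesis
        unfolding has_field_derivative_def .
    qed
    have cF': "continuous_on {x..x'} F"
      by (rule continuous_on_subset[OF cF]) (use that in auto)
    obtain \<xi> where \<xi>: "x < \<xi>" "\<xi> < x'" "F x' - F x = 1 / \<rho> \<xi> * (x' - x)"
      by (rule mvt[OF \<open>x < x'\<close> cF' dF])
    moreover have "0 < \<rho> \<xi>"
      using \<xi>(1) that(1) \<open>0 < m\<close> by (intro rho(2)) auto
    ultimately show ?thesis
      using \<open>x < x'\<close> by (metis diff_gt_0_iff_gt mult_pos_pos zero_less_divide_1_iff)
  qed
  have "y h \<in> {m..M}" "z h \<in> {m..M}"
    using mM(2,3) h by auto
  then show ?thesis
    using F_less[of "y h" "z h"] F_less[of "z h" "y h"] Feq by linarith
qed

text \<open>As functions of \<open>h\<close>, both sides solve the same autonomous equation from the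
  value \<open>\<sigma> s t\<close>, so uniqueness applies. The value s = 0 is treated apart because
  uniqueness is available for positive solutions.\<close>

lemma decay_flow_semigroup:
  assumes rho: "continuous_on {0..} \<rho>" "posdef \<rho>"
    and sigma: "\<sigma> \<in> KL"
      "\<forall>s\<ge>0. \<forall>t\<ge>0. (\<sigma> s has_real_derivative - \<rho> (\<sigma> s t)) (at t within {0..})"
      "\<forall>s\<ge>0. \<sigma> s 0 = s"
    and "0 \<le> s" "0 \<le> t" "0 \<le> h"
  shows "\<sigma> (\<sigma> s t) h = \<sigma> s (t + h)"
proof (cases "s = 0")
  case True
  then show ?thesis
    using KL_zero[OF sigma(1)] \<open>0 \<le> t\<close> \<open>0 \<le> h\<close> by simp
next
  case False
  then have "0 < s" using \<open>0 \<le> s\<close> by simp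
  define c where "c = \<sigma> s t"
  have "0 < c"
    unfolding c_def by (rule KL_pos[OF sigma(1) \<open>0 < s\<close> \<open>0 \<le> t\<close>])
  let ?z = "\<lambda>r. \<sigma> s (t + r)"
  have "\<sigma> c h = ?z h"
  proof (rule autonomous_decay_unique[of \<rho> h "\<sigma> c" ?z])
    show "\<sigma> c 0 = ?z 0"
      using sigma(3)[rule_format, of c] \<open>0 < c\<close> by (simp add: c_def)
  next
    fix r assume r: "0 \<le> r" "r \<le> h"
    have "(\<sigma> c has_real_derivative - \<rho> (\<sigma> c r)) (at r within {0..})"
      using sigma(2) \<open>0 < c\<close> r(1) less_imp_le by blast
    then show "(\<sigma> c has_real_derivative - \<rho> (\<sigma> c r)) (at r within {0..h})"
      by (rule DERIV_subset) simp
    have "(\<sigma> s has_real_derivative - \<rho> (?z r)) (at (t + r) within {0..})"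
      using sigma(2)[rule_format, of s "t + r"] \<open>0 \<le> s\<close> \<open>0 \<le> t\<close> r by simp
    \<comment> \<open>The chain rule for one-sided derivatives asks for the outer derivative within
      the image of the translated interval.\<close>
    then have "(\<sigma> s has_real_derivative - \<rho> (?z r)) (at (t + r) within (+) t ` {0..h})"
      by (rule DERIV_subset) (use \<open>0 \<le> t\<close> in auto)
    moreover have "((+) t has_real_derivative 1) (at r within {0..h})"
      by (auto intro!: derivative_eq_intros)
    ultimately show "(?z has_real_derivative - \<rho> (?z r)) (at r within {0..h})"
      using DERIV_image_chain[of "\<sigma> s" "- \<rho> (?z r)" "(+) t" r "{0..h}" 1]
      unfolding o_def by simp
    show "0 < \<sigma> c r" "0 < ?z r"
      using KL_pos[OF sigma(1)] \<open>0 < s\<close> \<open>0 < c\<close> \<open>0 \<le> t\<close> r by simp_all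
  qed (use rho \<open>0 \<le> h\<close> in \<open>simp_all add: posdef_def\<close>)
  then show ?thesis
    by (simp add: c_def)
qed

text \<open>Induction over equal short steps: the semigroup law concatenates the decay, and the
  ceiling \<open>K\<close> survives each step because \<open>\<sigma>\<close> cannot raise
  it.\<close>

lemma decay_max_iterate:
  fixes W :: "real \<Rightarrow> real"
  assumes sigma: "\<sigma> \<in> KL" "\<And>s. 0 \<le> s \<Longrightarrow> \<sigma> s 0 = s"
      "\<And>s t h. 0 \<le> s \<Longrightarrow> 0 \<le> t \<Longrightarrow> 0 \<le> h \<Longrightarrow> \<sigma> (\<sigma> s t) h = \<sigma> s (t + h)"
    and W: "\<And>t. t0 \<le> t \<Longrightarrow> 0 \<le> W t" and K: "0 \<le> K"
    and \<epsilon>: "0 < \<epsilon>" and T: "t0 \<le> T"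
    and step: "\<And>t h. t0 \<le> t \<Longrightarrow> 0 < h \<Longrightarrow> h \<le> \<epsilon> \<Longrightarrow> t + h \<le> T \<Longrightarrow> W (t + h) \<le> max (\<sigma> (W t) h) K"
  shows "W T \<le> max (\<sigma> (W t0) (T - t0)) K"
proof (cases "T = t0")
  case True
  then show ?thesis using sigma(2)[of "W t0"] W by auto
next
  case False
  then have "t0 < T" using T by simp
  obtain n where n: "(T - t0) / \<epsilon> < real n"
    using reals_Archimedean2 by blast
  have "0 < n" using n \<open>t0 < T\<close> \<epsilon> by (metis diff_gt_0_iff_gt divide_pos_pos gr0I less_asym of_nat_0)
  \<comment> \<open>The choice of \<open>n\<close> makes \<open>h\<close> at most \<epsilon>, while
    \<open>n\<close> steps end exactly at \<open>T\<close>.\<close>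
  define h where "h = (T - t0) / real n"
  have h: "0 < h" "h \<le> \<epsilon>" "real n * h = T - t0"
    using n \<open>0 < n\<close> \<open>t0 < T\<close> \<epsilon> by (auto simp: h_def field_simps)
  have "W (t0 + real k * h) \<le> max (\<sigma> (W t0) (real k * h)) K" if "k \<le> n" for k
    using that
  proof (induction k)
    case 0
    then show ?case using sigma(2)[of "W t0"] W by auto
  next
    case (Suc k)
    let ?t = "t0 + real k * h" and ?c = "\<sigma> (W t0) (real k * h)"
    have t: "t0 \<le> ?t" using h by simp
    have "real (Suc k) * h \<le> real n * h"
      using Suc.prems h by (intro mult_right_mono) auto
    then have "W (?t + h) \<le> max (\<sigma> (W ?t) h) K"
      using h t by (intro step) (auto simp: algebra_simps)
    moreover have "\<sigma> (W ?t) h \<le> \<sigma> (max ?c K) h"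
      using Suc W[OF t] h by (intro KL_mono[OF sigma(1)]) auto
    \<comment> \<open>If \<open>K\<close> is the larger entry, then \<open>\<sigma> K h\<close> is
      at most \<open>\<sigma> K 0\<close>, which is \<open>K\<close>.\<close>
    moreover have "\<sigma> (max ?c K) h \<le> max (\<sigma> ?c h) K"
      using KL_antimono[OF sigma(1) K, of 0 h] sigma(2)[OF K] h by (auto simp: max_def)
    moreover have "\<sigma> ?c h = \<sigma> (W t0) (real k * h + h)"
      using W h by (intro sigma(3)) auto
    ultimately show ?case
      by (simp add: algebra_simps)
  qed
  from this[of n] show ?thesis using h by simp
qed


section \<open>Histories of solutions and the short-step map\<close>

lemma hist_app: "-r \<le> \<theta> \<Longrightarrow> \<theta> \<le> 0 \<Longrightarrow> hist r t x \<theta> = x (t + \<theta>)"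
  by (simp add: hist_def)

text \<open>Measurability rests on translations being Lebesgue measurable; the function is first
  extended by 0 so that the translation acts on the whole line.\<close>

lemma hist_Linf:
  fixes x :: "real \<Rightarrow> 'a::euclidean_space"
  assumes x: "x \<in> Linf_loc {t0 - r..} UNIV" and t: "t0 \<le> t"
  shows "hist r t x \<in> Linf {-r..0} UNIV"
proof -
  let ?g = "\<lambda>s. if s \<in> {t0 - r..} then x s else 0"
  have "?g \<in> borel_measurable lebesgue"
    using x by (intro borel_measurable_if_I) (auto simp: Linf_loc_def)
  moreover have "(\<lambda>\<theta>. t + \<theta>) \<in> lebesgue \<rightarrow>\<^sub>M lebesgue"
    using lebesgue_affine_measurable[of "\<lambda>_::real. 1" t] by simp
  ultimately have "(\<lambda>\<theta>. ?g (t + \<theta>)) \<in> borel_measurable lebesgue"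
    by (rule measurable_compose_rev)
  then have "(\<lambda>\<theta>. ?g (t + \<theta>)) \<in> borel_measurable (lebesgue_on {-r..0})"
    by (rule measurable_restrict_space1)
  then have "hist r t x \<in> borel_measurable (lebesgue_on {-r..0})"
    by (subst measurable_cong[where g = "\<lambda>\<theta>. ?g (t + \<theta>)"])
      (use t in \<open>auto simp: hist_def space_restrict_space\<close>)
  moreover have "bounded (hist r t x ` {-r..0})"
  proof -
    have "bounded (x ` {t - r..t})"
      using x t by (auto simp: Linf_loc_def)
    then show ?thesis
      by (rule bounded_subset) (auto simp: hist_def)
  qed
  ultimately show ?thesis
    by (auto simp: Linf_def hist_def)
qed

lemma norm_le_supnorm:
  assumes "x \<in> Linf {-r..0} UNIV" "-r \<le> \<theta>" "\<theta> \<le> 0"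
  shows "norm (x \<theta>) \<le> supnorm r x"
proof -
  have "bdd_above ((\<lambda>\<theta>. norm (x \<theta>)) ` {-r..0})"
    using assms(1) by (auto simp: Linf_def bounded_iff bdd_above_def)
  then show ?thesis
    unfolding supnorm_def using assms by (intro cSUP_upper) auto
qed

lemma supnorm_nonneg: "x \<in> Linf {-r..0} UNIV \<Longrightarrow> 0 \<le> r \<Longrightarrow> 0 \<le> supnorm r x"
  using norm_le_supnorm[of x r 0] norm_ge_zero[of "x 0"] by (meson neg_le_0_iff_le order_refl order_trans)

text \<open>A real-valued \<open>SUP\<close> can be compared with its terms only when the set is
  bounded above. On a compact interval the weight is bounded by continuity and the input by local
  boundedness; monotonicity of \<open>k\<close> does the rest.\<close>

lemma bdd_above_classN_weighted:
  fixes w :: "real \<Rightarrow> 'a::euclidean_space"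
  assumes k: "k \<in> classN" and \<delta>: "\<delta> \<in> Kplus" and w: "w \<in> Linf_loc {0..} S" and "0 \<le> a"
  shows "bdd_above ((\<lambda>s. k (\<delta> s * norm (w s))) ` {a..b})"
proof -
  have "bounded (w ` {a..b})"
    using w \<open>0 \<le> a\<close> by (auto simp: Linf_loc_def)
  then obtain W where W: "\<And>s. s \<in> {a..b} \<Longrightarrow> norm (w s) \<le> W"
    unfolding bounded_iff by blast
  have "continuous_on {a..b} \<delta>"
    using \<delta> \<open>0 \<le> a\<close> by (auto simp: Kplus_def intro: continuous_on_subset)
  then have "bounded (\<delta> ` {a..b})"
    by (intro compact_imp_bounded compact_continuous_image) auto
  then obtain E where E: "\<And>s. s \<in> {a..b} \<Longrightarrow> norm (\<delta> s) \<le> E"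
    unfolding bounded_iff by blast
  have "k (\<delta> s * norm (w s)) \<le> k (E * W)" if s: "s \<in> {a..b}" for s
  proof (rule mono_onD[of "{0..}" k])
    show "mono_on {0..} k" using k by (simp add: classN_def)
    have "0 < \<delta> s" using \<delta> s \<open>0 \<le> a\<close> by (auto simp: Kplus_def)
    then have "\<delta> s \<le> E" using E[OF s] by simp
    show "\<delta> s * norm (w s) \<le> E * W"
      using \<open>0 < \<delta> s\<close> \<open>\<delta> s \<le> E\<close> W[OF s] by (intro mult_mono) auto
    then show "\<delta> s * norm (w s) \<in> {0..}" "E * W \<in> {0..}"
      using \<open>0 < \<delta> s\<close> by (auto intro: order_trans[rotated])
  qed
  then show ?thesis
    by (rule bdd_aboveI2)
qed

lemma classN_nonneg: "k \<in> classN \<Longrightarrow> 0 \<le> x \<Longrightarrow> 0 \<le> k x"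
  unfolding classN_def using mono_onD[of "{0..}" k 0 x] by auto

lemma classN_comp:
  assumes k: "mono_on {0..} k" "k 0 = 0" and l: "l \<in> classN"
  shows "(\<lambda>s. k (l s)) \<in> classN"
proof -
  have "k (l x) \<le> k (l y)" if "0 \<le> x" "x \<le> y" for x y
    using mono_onD[OF k(1), of "l x" "l y"] mono_onD[of "{0..}" l x y] classN_nonneg[OF l] l that
    by (simp add: classN_def)
  then show ?thesis
    using k(2) l by (auto simp: classN_def intro!: mono_onI)
qed

text \<open>For t \<le> T the window seen by \<open>g_step\<close> lies in [0, T + 1], where the
  continuous delay has a positive minimum. This supplies the uniform step length for the
  iteration.\<close>

lemma g_step_lower:
  assumes tau: "continuous_on {0..} \<tau>" "\<And>t. 0 \<le> t \<Longrightarrow> 0 < \<tau> t" and "0 \<le> T"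
  obtains \<epsilon> where "0 < \<epsilon>" "\<And>t. 0 \<le> t \<Longrightarrow> t \<le> T \<Longrightarrow> \<epsilon> \<le> g_step \<tau> t"
proof -
  have "compact (\<tau> ` {0..T + 1})"
    using continuous_on_subset[OF tau(1)] by (intro compact_continuous_image) auto
  then obtain m where m: "m \<in> \<tau> ` {0..T + 1}" "\<And>s. s \<in> \<tau> ` {0..T + 1} \<Longrightarrow> m \<le> s"
    using compact_attains_inf[of "\<tau> ` {0..T + 1}"] \<open>0 \<le> T\<close> by auto
  show thesis
  proof
    show "0 < min 1 m"
      using m(1) tau(2) by auto
    show "min 1 m \<le> g_step \<tau> t" if "0 \<le> t" "t \<le> T" for t
      unfolding g_step_def using that by (intro min.mono cINF_greatest m(2)) auto
  qed
qed

lemma g_step_le_1: "g_step \<tau> t \<le> 1"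
  by (simp add: g_step_def)

lemma g_step_le_tau:
  assumes tau: "\<And>t. 0 \<le> t \<Longrightarrow> 0 < \<tau> t" and "0 \<le> t" "t \<le> s" "s \<le> t + 1"
  shows "g_step \<tau> t \<le> \<tau> s"
proof -
  have "bdd_below (\<tau> ` {t..t + 1})"
    by (rule bdd_belowI2[of _ 0]) (use tau \<open>0 \<le> t\<close> in \<open>force intro: less_imp_le\<close>)
  then have "(INF s\<in>{t..t + 1}. \<tau> s) \<le> \<tau> s"
    by (rule cINF_lower) (use assms in auto)
  then show ?thesis
    by (simp add: g_step_def)
qed

text \<open>A step of length at most \<open>g(t)\<close> evaluates \<open>f\<^sub>2\<close> only at times \<open>s \<le> t + \<tau>(s)\<close>, hence only
  on the part of the trajectory already stored in the history at time \<open>t\<close>.\<close>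

lemma G_step_solution:
  assumes sol: "is_solution r2 \<tau> f2 t0 x20 v2 u d x2"
    and tau: "\<And>t. 0 \<le> t \<Longrightarrow> 0 < \<tau> t \<and> \<tau> t \<le> r2"
    and t: "0 \<le> t0" "t0 \<le> t" and h: "0 < h" "h \<le> g_step \<tau> t"
  shows "G_step r2 \<tau> f2 h t (hist r2 t x2) d u v2 = hist r2 (t + h) x2"
proof
  fix \<theta>
  have g: "h \<le> \<tau> s" if "t \<le> s" "s \<le> t + 1" for s
    using g_step_le_tau[of \<tau> t s] tau t h that by auto
  have "h \<le> r2"
    using g[of t] tau[of t] t by simp
  show "G_step r2 \<tau> f2 h t (hist r2 t x2) d u v2 \<theta> = hist r2 (t + h) x2 \<theta>"
  proof (cases "\<theta> \<in> {-r2..0}")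
    case in_dom: True
    show ?thesis
    proof (cases "\<theta> \<le> - h")
      case True
      then show ?thesis
        using in_dom h \<open>h \<le> r2\<close> by (simp add: G_step_def hist_app add.assoc)
    next
      case False
      define s where "s = t + h + \<theta>"
      have s: "t < s" "s \<le> t + h" "s \<le> t + 1"
        using False in_dom h g_step_le_1[of \<tau> t] by (auto simp: s_def)
      have "h \<le> \<tau> s" "\<tau> s \<le> r2"
        using g[of s] tau[of s] s t by auto
      \<comment> \<open>The arguments read from the stored history stay in [-r2, 0]: they are at
        most s - t - \<tau>(s) \<le> h - \<tau>(s) \<le> 0 and at least s - t - r2 > -r2.\<close>
      then have "hist (r2 - \<tau> s) (s - t - \<tau> s) (hist r2 t x2) = hist (r2 - \<tau> s) (s - \<tau> s) x2"
        unfolding hist_def restrict_def using s by (auto simp: fun_eq_iff algebra_simps)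
      then have "G_step r2 \<tau> f2 h t (hist r2 t x2) d u v2 \<theta>
          = f2 s (d s) (hist (r2 - \<tau> s) (s - \<tau> s) x2) (u s) (v2 s)"
        using False in_dom by (simp add: G_step_def s_def Let_def)
      also have "\<dots> = x2 s"
        using sol s t by (simp add: is_solution_def)
      finally show ?thesis
        using in_dom by (simp add: hist_app s_def)
    qed
  qed (auto simp: G_step_def hist_def)
qed

text \<open>Each step is the hypothesis on \<open>V\<close> read along the solution through
  \<open>G_step_solution\<close>. The suprema over the small step intervals are enlarged to
  \<open>{t0..t}\<close>, so that the iteration sees one fixed ceiling.\<close>

lemma solution_V_decay:
  assumes sys: "difference_system r2 D U S1 S2 \<tau> f2 H2"
    and V_nonneg: "\<forall>t\<ge>0. \<forall>x2\<in>Linf {-r2..0} UNIV. 0 \<le> V t x2"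
    and zeta: "\<zeta> \<in> classN" "\<zeta>u \<in> classN"
    and weights: "\<delta>2 \<in> Kplus" "\<delta>2u \<in> Kplus"
    and rho: "continuous_on {0..} \<rho>" "posdef \<rho>"
    and sigma: "\<sigma> \<in> KL"
      "\<forall>s\<ge>0. \<forall>t\<ge>0. (\<sigma> s has_real_derivative - \<rho> (\<sigma> s t)) (at t within {0..})"
      "\<forall>s\<ge>0. \<sigma> s 0 = s"
    and V_step: "\<forall>t\<ge>0. \<forall>x2\<in>Linf {-r2..0} UNIV.
      \<forall>u\<in>Linf_loc {0..} U. \<forall>v2\<in>Linf_loc {0..} S1. \<forall>d\<in>Linf_loc {0..} D.
      \<forall>h. 0 < h \<and> h \<le> g_step \<tau> t \<longrightarrow>
        V (t + h) (G_step r2 \<tau> f2 h t x2 d u v2)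
          \<le> Max {\<sigma> (V t x2) h,
                 SUP s\<in>{t..t + h}. \<zeta> (\<delta>2 s * norm (v2 s)),
                 SUP s\<in>{t..t + h}. \<zeta>u (\<delta>2u s * norm (u s))}"
    and sol: "is_solution r2 \<tau> f2 t0 x20 v2 u d x2"
    and inputs: "v2 \<in> Linf_loc {0..} S1" "u \<in> Linf_loc {0..} U" "d \<in> Linf_loc {0..} D"
    and t: "0 \<le> t0" "t0 \<le> t"
  shows "V t (hist r2 t x2) \<le> max (\<sigma> (V t0 x20) (t - t0))
      (max (SUP s\<in>{t0..t}. \<zeta> (\<delta>2 s * norm (v2 s))) (SUP s\<in>{t0..t}. \<zeta>u (\<delta>2u s * norm (u s))))"
proof -
  interpret difference_system r2 D U S1 S2 \<tau> f2 H2 by (rule sys)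
  have hist: "hist r2 t x2 \<in> Linf {-r2..0} UNIV" if "t0 \<le> t" for t
    using sol that by (intro hist_Linf) (auto simp: is_solution_def)
  have x20: "hist r2 t0 x2 = x20"
    using sol by (simp add: is_solution_def)
  obtain \<epsilon> where \<epsilon>: "0 < \<epsilon>" "\<And>s. 0 \<le> s \<Longrightarrow> s \<le> t \<Longrightarrow> \<epsilon> \<le> g_step \<tau> s"
    using g_step_lower[OF tau_cont, of t] tau_bounds t by auto
  let ?Zv = "\<lambda>I. SUP s\<in>I. \<zeta> (\<delta>2 s * norm (v2 s))"
  let ?Zu = "\<lambda>I. SUP s\<in>I. \<zeta>u (\<delta>2u s * norm (u s))"
  have bdd_v: "bdd_above ((\<lambda>s. \<zeta> (\<delta>2 s * norm (v2 s))) ` {t0..t})"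
    by (rule bdd_above_classN_weighted[OF zeta(1) weights(1) inputs(1) t(1)])
  have bdd_u: "bdd_above ((\<lambda>s. \<zeta>u (\<delta>2u s * norm (u s))) ` {t0..t})"
    by (rule bdd_above_classN_weighted[OF zeta(2) weights(2) inputs(2) t(1)])
  \<comment> \<open>The ceiling must be nonnegative; the first supremum dominates its nonnegative
    term at \<open>t\<close>.\<close>
  have "0 \<le> \<delta>2 t"
    using weights(1) t by (simp add: Kplus_def less_imp_le)
  then have "0 \<le> \<zeta> (\<delta>2 t * norm (v2 t))"
    by (intro classN_nonneg[OF zeta(1)]) simp
  also have "\<dots> \<le> ?Zv {t0..t}"
    using t by (intro cSUP_upper bdd_v) auto
  finally have K: "0 \<le> max (?Zv {t0..t}) (?Zu {t0..t})"
    by simp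
  have "V t (hist r2 t x2) \<le> max (\<sigma> (V t0 (hist r2 t0 x2)) (t - t0)) (max (?Zv {t0..t}) (?Zu {t0..t}))"
  proof (rule decay_max_iterate[where \<sigma> = \<sigma> and \<epsilon> = \<epsilon>
        and W = "\<lambda>t. V t (hist r2 t x2)"])
    fix s h assume s: "t0 \<le> s" "0 < h" "h \<le> \<epsilon>" "s + h \<le> t"
    then have h: "h \<le> g_step \<tau> s"
      using \<epsilon>(2)[of s] t by simp
    have "V (s + h) (G_step r2 \<tau> f2 h s (hist r2 s x2) d u v2)
          \<le> max (\<sigma> (V s (hist r2 s x2)) h) (max (?Zv {s..s + h}) (?Zu {s..s + h}))"
      using V_step[rule_format, of s "hist r2 s x2" u v2 d h] hist s inputs h t by simp
    moreover have "G_step r2 \<tau> f2 h s (hist r2 s x2) d u v2 = hist r2 (s + h) x2"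
      using G_step_solution[OF sol tau_bounds] s t h by simp
    moreover have "?Zv {s..s + h} \<le> ?Zv {t0..t}"
      using s by (intro cSUP_subset_mono bdd_v) auto
    moreover have "?Zu {s..s + h} \<le> ?Zu {t0..t}"
      using s by (intro cSUP_subset_mono bdd_u) auto
    ultimately show "V (s + h) (hist r2 (s + h) x2)
        \<le> max (\<sigma> (V s (hist r2 s x2)) h) (max (?Zv {t0..t}) (?Zu {t0..t}))"
      by auto
  qed (use sigma K \<epsilon> t hist V_nonneg decay_flow_semigroup[OF rho sigma] in auto)
  then show ?thesis
    unfolding x20 .
qed


section \<open>Comparison tools for the two estimates\<close>

text \<open>With \<open>a2\<close> for \<open>a\<close> and the inverse of \<open>a1\<close> for
  \<open>b\<close>, this provides the function \<open>\<sigma>2\<close> of the output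
  estimate.\<close>

lemma KL_comp_Kinf:
  assumes \<sigma>: "\<sigma> \<in> KL" and a: "a \<in> Kinf" and b: "b \<in> Kinf"
  shows "(\<lambda>s t. b (\<sigma> (a s) t)) \<in> KL"
proof -
  have \<sigma>c: "continuous_on ({0..} \<times> {0..}) (\<lambda>(s, t). \<sigma> s t)"
    and \<sigma>lim: "\<And>s. 0 \<le> s \<Longrightarrow> (\<sigma> s \<longlongrightarrow> 0) at_top"
    using \<sigma> unfolding KL_def by blast+
  note A = KinfD[OF a] and B = KinfD[OF b]
  have "continuous_on ({0..} \<times> {0..}) (\<lambda>x. (a (fst x), snd x))"
    by (intro continuous_on_Pair continuous_on_snd continuous_on_compose2[OF A(1)]
        continuous_on_fst continuous_on_id) auto
  then have "continuous_on ({0..} \<times> {0..}) (\<lambda>x. (\<lambda>(s, t). \<sigma> s t) (a (fst x), snd x))"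
    by (rule continuous_on_compose2[OF \<sigma>c]) (auto simp: A(5))
  then have "continuous_on ({0..} \<times> {0..}) (\<lambda>x. b (\<sigma> (a (fst x)) (snd x)))"
    by (intro continuous_on_compose2[OF B(1)]) (auto simp: KL_nonneg[OF \<sigma>] A(5))
  then have cont: "continuous_on ({0..} \<times> {0..}) (\<lambda>(s, t). b (\<sigma> (a s) t))"
    by (simp add: case_prod_unfold)
  have K: "(\<lambda>s. b (\<sigma> (a s) t)) \<in> classK" if t: "0 \<le> t" for t
  proof -
    have S: "continuous_on {0..} (\<lambda>s. \<sigma> s t)" "strict_mono_on {0..} (\<lambda>s. \<sigma> s t)"
      using KL_classK[OF \<sigma> t] unfolding classK_def by blast+
    have "continuous_on {0..} (\<lambda>s. \<sigma> (a s) t)"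
      by (rule continuous_on_compose2[OF S(1) A(1)]) (auto simp: A(5))
    then have c: "continuous_on {0..} (\<lambda>s. b (\<sigma> (a s) t))"
      by (rule continuous_on_compose2[OF B(1)]) (auto simp: KL_nonneg[OF \<sigma> _ t] A(5))
    have less: "b (\<sigma> (a x) t) < b (\<sigma> (a y) t)" if "0 \<le> x" "x < y" for x y
    proof -
      have "a x < a y"
        using strict_mono_onD[OF A(2)] that by simp
      then have "\<sigma> (a x) t < \<sigma> (a y) t"
        using strict_mono_onD[OF S(2), of "a x" "a y"] A(5) that by simp
      then show ?thesis
        using strict_mono_onD[OF B(2), of "\<sigma> (a x) t" "\<sigma> (a y) t"] KL_nonneg[OF \<sigma> _ t] A(5) that by simp
    qed
    have "b (\<sigma> (a 0) t) = 0"
      using KL_zero[OF \<sigma> t] A(4) B(4) by simp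
    then show ?thesis
      using c less less[of 0] by (auto simp: classK_def posdef_def intro!: strict_mono_onI)
  qed
  have anti: "antimono_on {0..} (\<lambda>t. b (\<sigma> (a s) t))" if s: "0 \<le> s" for s
  proof (rule monotone_onI)
    fix x y :: real assume xy: "x \<in> {0..}" "y \<in> {0..}" "x \<le> y"
    then have "\<sigma> (a s) y \<le> \<sigma> (a s) x"
      using KL_antimono[OF \<sigma>] A(5) s by simp
    then show "b (\<sigma> (a s) y) \<le> b (\<sigma> (a s) x)"
      using mono_onD[OF B(3), of "\<sigma> (a s) y" "\<sigma> (a s) x"] KL_nonneg[OF \<sigma>] A(5) s xy by simp
  qed
  have lim: "((\<lambda>t. b (\<sigma> (a s) t)) \<longlongrightarrow> 0) at_top" if s: "0 \<le> s" for s
  proof -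
    have "eventually (\<lambda>t. \<sigma> (a s) t \<in> {0..}) at_top"
      using eventually_ge_at_top[of 0] by eventually_elim (simp add: KL_nonneg[OF \<sigma>] A(5) s)
    then have "((\<lambda>t. b (\<sigma> (a s) t)) \<longlongrightarrow> b 0) at_top"
      by (intro continuous_on_tendsto_compose[OF B(1) \<sigma>lim]) (auto simp: A(5) s)
    then show ?thesis
      by (simp add: B(4))
  qed
  show ?thesis
    unfolding KL_def using cont K anti lim by blast
qed

lemma mono_on_max:
  fixes k :: "real \<Rightarrow> real"
  assumes "mono_on {0..} k" "0 \<le> x" "0 \<le> y"
  shows "k (max x y) = max (k x) (k y)"
  using mono_onD[OF assms(1), of x y] mono_onD[OF assms(1), of y x] assms(2,3)
  by (auto simp: max_def)

text \<open>This separates factors depending on different data, since the state estimate allows only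
  a maximum of separate terms.\<close>

lemma mult_le_max_power2: "x * y \<le> max (x\<^sup>2) (y\<^sup>2)" for x y :: real
proof -
  have "2 * (x * y) \<le> x\<^sup>2 + y\<^sup>2"
    using sum_squares_bound[of x y] by simp
  then show ?thesis by simp
qed

text \<open>The static core of the state estimate: \<open>m\<close> and \<open>m0\<close> stand for
  the majorant \<open>M\<close> at the current and the initial time, \<open>N\<close> for the norm
  of the initial history, \<open>X\<close> for a later state norm. In \<open>q\<close>, the factor 2
  comes from replacing a sum by a maximum and the square from splitting a product.\<close>

lemma weighted_norm_bound:
  fixes m m0 \<mu>s \<phi>t b N X Z Zu R :: real
  assumes p: "p \<in> Kinf" and a: "a \<in> Kinf"
    and \<mu>: "0 < \<mu>s" "1 / \<mu>s \<le> m" and \<phi>: "0 \<le> \<phi>t" "\<phi>t \<le> m" and b: "0 \<le> b" "b \<le> m0"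
    and nn: "0 \<le> N" "0 \<le> X" "0 \<le> Z" "0 \<le> Zu" "0 \<le> R"
    and X: "p (\<mu>s * X) \<le> max (a (b * N)) (max Z Zu) + R"
  defines "q \<equiv> \<lambda>w. (the_inv_into {0..} p (2 * w))\<^sup>2"
  shows "\<phi>t * X \<le> max (m ^ 4) (max (q R) (max (max (q (a (m0\<^sup>2))) (q (a (N\<^sup>2)))) (max (q Z) (q Zu))))"
proof -
  note A = KinfD[OF a]
  define r where "r = the_inv_into {0..} p"
  have rK: "r \<in> Kinf" and rp: "\<And>x. 0 \<le> x \<Longrightarrow> r (p x) = x"
    using Kinf_inverse[OF p] by (auto simp: r_def)
  note r = KinfD[OF rK]
  have q_mono: "mono_on {0..} q"
  proof (rule mono_onI)
    fix x y :: real assume "x \<in> {0..}" "y \<in> {0..}" "x \<le> y"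
    then show "q x \<le> q y"
      unfolding q_def r_def[symmetric] using r(5) by (intro power_mono mono_onD[OF r(3)]) auto
  qed
  have qa_mono: "mono_on {0..} (\<lambda>x. q (a x))"
    using A(5) by (auto intro!: mono_onI mono_onD[OF q_mono] mono_onD[OF A(3)])
  define W where "W = max (a (b * N)) (max Z Zu)"
  have W: "0 \<le> W"
    using nn by (simp add: W_def)
  \<comment> \<open>A sum is at most twice the maximum, and a maximum commutes with the monotone
    inverse of \<open>p\<close>.\<close>
  have "p (\<mu>s * X) \<le> 2 * max R W"
    using X unfolding W_def[symmetric] by simp
  then have "r (p (\<mu>s * X)) \<le> r (2 * max R W)"
    using nn W \<mu> KinfD(5)[OF p] by (intro mono_onD[OF r(3)]) auto
  then have "\<mu>s * X \<le> r (2 * max R W)"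
    using rp nn \<mu> by simp
  then have "X \<le> 1 / \<mu>s * r (2 * max R W)"
    using \<mu> by (simp add: field_simps)
  also have "\<dots> \<le> m * r (2 * max R W)"
    using \<mu> r(5) nn by (intro mult_right_mono) auto
  \<comment> \<open>One factor \<open>m\<close> bounds the weight \<open>\<phi>t\<close>, the other
    bounds 1/\<open>\<mu>s\<close>; squaring their product in the next split gives the fourth
    power.\<close>
  finally have "\<phi>t * X \<le> m * (m * r (2 * max R W))"
    using \<phi> nn by (intro mult_mono) auto
  also have "\<dots> = m\<^sup>2 * r (2 * max R W)"
    by (simp add: power2_eq_square)
  also have "\<dots> \<le> max ((m\<^sup>2)\<^sup>2) ((r (2 * max R W))\<^sup>2)"
    by (rule mult_le_max_power2)
  also have "\<dots> = max (m ^ 4) (q (max R W))"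
    by (simp add: q_def r_def flip: power_mult)
  also have "q (max R W) = max (q R) (max (q (a (b * N))) (max (q Z) (q Zu)))"
    using nn W A(5) b unfolding W_def by (simp add: mono_on_max[OF q_mono])
  finally have le: "\<phi>t * X \<le> max (m ^ 4) (max (q R) (max (q (a (b * N))) (max (q Z) (q Zu))))" .
  \<comment> \<open>The same splitting separates the weight at the initial time from the size of the
    initial history.\<close>
  have "q (a (b * N)) \<le> q (a (max (m0\<^sup>2) (N\<^sup>2)))"
  proof (rule mono_onD[OF qa_mono])
    have "b * N \<le> m0 * N"
      using b nn by (intro mult_right_mono)
    then show "b * N \<le> max (m0\<^sup>2) (N\<^sup>2)"
      using mult_le_max_power2 order_trans by blast
  qed (use b nn in \<open>auto simp: le_max_iff_disj\<close>)
  also have "\<dots> = max (q (a (m0\<^sup>2))) (q (a (N\<^sup>2)))"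
    by (rule mono_on_max[OF qa_mono]) auto
  finally show ?thesis
    by (intro order_trans[OF le] max.mono order_refl)
qed

section \<open>Estimates along solutions of the difference system\<close>

theorem theorem3p6:
  fixes r2 :: real
    and D :: "(real ^ 'l) set"
    and U :: "(real ^ 'm) set"
    and S1 :: "(real ^ 'k1) set"
    and S2 :: "(real ^ 'k2) set"
    and \<tau> :: "real \<Rightarrow> real"
    and f2 :: "real \<Rightarrow> real ^ 'l \<Rightarrow> (real \<Rightarrow> real ^ 'n2) \<Rightarrow> real ^ 'm \<Rightarrow> real ^ 'k1 \<Rightarrow> real ^ 'n2"
    and H2 :: "real \<Rightarrow> (real \<Rightarrow> real ^ 'n2) \<Rightarrow> real ^ 'k2"
    and V :: "real \<Rightarrow> (real \<Rightarrow> real ^ 'n2) \<Rightarrow> real"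
    and a1 a2 p \<zeta> \<zeta>u \<beta> \<delta>2 \<delta>2u \<rho> \<mu> :: "real \<Rightarrow> real"
    and \<sigma> :: "real \<Rightarrow> real \<Rightarrow> real"
    and R :: real
  defines "A \<equiv> \<forall>t\<ge>0. \<forall>x2\<in>Linf {-r2..0} UNIV.
      a1 (norm (H2 t (hist (r2 - \<tau> t) (- \<tau> t) x2))) \<le> V t x2"
    and "B \<equiv> \<forall>t\<ge>0. \<forall>x2\<in>Linf {-r2..0} UNIV. p (\<mu> t * norm (x2 0)) \<le> V t x2 + R"
  assumes system: "difference_system r2 D U S1 S2 \<tau> f2 H2"
    and V_nonneg: "\<forall>t\<ge>0. \<forall>x2\<in>Linf {-r2..0} UNIV. 0 \<le> V t x2"
    and a2: "a2 \<in> Kinf"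
    and zeta: "\<zeta> \<in> classN" "\<zeta>u \<in> classN"
    and weights: "\<beta> \<in> Kplus" "\<delta>2 \<in> Kplus" "\<delta>2u \<in> Kplus"
    and rho: "continuous_on {0..} \<rho>" "posdef \<rho>"
    and sigma: "\<sigma> \<in> KL"
      "\<forall>s\<ge>0. \<forall>t\<ge>0. (\<sigma> s has_real_derivative - \<rho> (\<sigma> s t)) (at t within {0..})"
      "\<forall>s\<ge>0. \<sigma> s 0 = s"
    and V_upper: "\<forall>t\<ge>0. \<forall>x2\<in>Linf {-r2..0} UNIV. V t x2 \<le> a2 (\<beta> t * supnorm r2 x2)"
    and V_step: "\<forall>t\<ge>0. \<forall>x2\<in>Linf {-r2..0} UNIV.
      \<forall>u\<in>Linf_loc {0..} U. \<forall>v2\<in>Linf_loc {0..} S1. \<forall>d\<in>Linf_loc {0..} D.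
      \<forall>h. 0 < h \<and> h \<le> g_step \<tau> t \<longrightarrow>
        V (t + h) (G_step r2 \<tau> f2 h t x2 d u v2)
          \<le> Max {\<sigma> (V t x2) h,
                 SUP s\<in>{t..t + h}. \<zeta> (\<delta>2 s * norm (v2 s)),
                 SUP s\<in>{t..t + h}. \<zeta>u (\<delta>2u s * norm (u s))}"
    and lower: "a1 \<in> Kinf" "p \<in> Kinf" "\<mu> \<in> Kplus" "R \<ge> 0"
    and A_or_B: "A \<or> B"
  shows
    "(A \<longrightarrow>
       (\<exists>\<sigma>2\<in>KL. \<forall>t0\<ge>0. \<forall>x20\<in>Linf {-r2..0} UNIV.
          \<forall>v2\<in>Linf_loc {0..} S1. \<forall>u\<in>Linf_loc {0..} U. \<forall>d\<in>Linf_loc {0..} D.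
          \<forall>x2. is_solution r2 \<tau> f2 t0 x20 v2 u d x2 \<longrightarrow>
            (\<forall>t\<ge>t0. norm (H2 t (hist (r2 - \<tau> t) (t - \<tau> t) x2))
               \<le> \<sigma>2 (\<beta> t0 * supnorm r2 x20) (t - t0)
                  + (SUP s\<in>{t0..t}. the_inv_into {0..} a1 (\<zeta> (\<delta>2 s * norm (v2 s))))
                  + (SUP s\<in>{t0..t}. the_inv_into {0..} a1 (\<zeta>u (\<delta>2u s * norm (u s)))))))
     \<and>
     (B \<and> (\<forall>t\<ge>0. \<delta>2 t = 1) \<longrightarrow>
       (\<forall>\<phi>\<in>Kplus. \<exists>\<mu>2\<in>Kplus. \<exists>c2\<in>Kplus. \<exists>g2\<in>classN. \<exists>p2\<in>classN. \<exists>p2u\<in>classN.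
          (\<forall>t0\<ge>0. \<forall>x20\<in>Linf {-r2..0} UNIV.
             \<forall>v2\<in>Linf_loc {0..} S1. \<forall>u\<in>Linf_loc {0..} U. \<forall>d\<in>Linf_loc {0..} D.
             \<forall>x2. is_solution r2 \<tau> f2 t0 x20 v2 u d x2 \<longrightarrow>
               (\<forall>t\<ge>t0. \<phi> t * supnorm r2 (hist r2 t x2)
                  \<le> Max {\<mu>2 (t - t0), c2 t0, g2 (supnorm r2 x20),
                         SUP s\<in>{t0..t}. p2 (norm (v2 s)),
                         SUP s\<in>{t0..t}. p2u (\<delta>2u s * norm (u s))}))
          \<and> (bounded (\<phi> ` {0..}) \<and> (\<exists>L>0. \<forall>t\<ge>0. \<beta> t + 1 / \<mu> t \<le> L)
               \<longrightarrow> bounded (c2 ` {0..}))))"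
proof (intro conjI impI)
  interpret difference_system r2 D U S1 S2 \<tau> f2 H2 by (rule system)
  have V_decay: "V t (hist r2 t x2) \<le> max (\<sigma> (a2 (\<beta> t0 * supnorm r2 x20)) (t - t0))
      (max (SUP s\<in>{t0..t}. \<zeta> (\<delta>2 s * norm (v2 s))) (SUP s\<in>{t0..t}. \<zeta>u (\<delta>2u s * norm (u s))))"
    if "0 \<le> t0" "x20 \<in> Linf {-r2..0} UNIV" "v2 \<in> Linf_loc {0..} S1" "u \<in> Linf_loc {0..} U"
      "d \<in> Linf_loc {0..} D" "is_solution r2 \<tau> f2 t0 x20 v2 u d x2" "t0 \<le> t" for t0 x20 v2 u d x2 t
  proof -
    have "\<sigma> (V t0 x20) (t - t0) \<le> \<sigma> (a2 (\<beta> t0 * supnorm r2 x20)) (t - t0)"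
      using V_nonneg V_upper that by (intro KL_mono[OF sigma(1)]) auto
    then show ?thesis
      by (intro order_trans[OF solution_V_decay[OF system V_nonneg zeta weights(2,3) rho sigma V_step
            that(6,3,4,5,1,7)]] max.mono order_refl)
  qed
  have hist_mem: "hist r2 t x2 \<in> Linf {-r2..0} UNIV"
    if "is_solution r2 \<tau> f2 t0 x20 v2 u d x2" "t0 \<le> t" for t0 x20 v2 u d x2 t
    using that by (intro hist_Linf) (auto simp: is_solution_def)
  have bdd_v: "bdd_above ((\<lambda>s. \<zeta> (\<delta>2 s * norm (v2 s))) ` {t0..t})"
    if "v2 \<in> Linf_loc {0..} S1" "0 \<le> t0" for v2 t0 t
    by (rule bdd_above_classN_weighted[OF zeta(1) weights(2) that])
  have bdd_u: "bdd_above ((\<lambda>s. \<zeta>u (\<delta>2u s * norm (u s))) ` {t0..t})"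
    if "u \<in> Linf_loc {0..} U" "0 \<le> t0" for u t0 t
    by (rule bdd_above_classN_weighted[OF zeta(2) weights(3) that])
  have pos: "0 < \<beta> t" "0 < \<delta>2 t" "0 < \<delta>2u t" "0 < \<mu> t" if "0 \<le> t" for t
    using weights lower(3) that unfolding Kplus_def by blast+
  have nn_v: "0 \<le> \<zeta> (\<delta>2 s * norm (v2 s))" if "0 \<le> s" for s and v2 :: "real \<Rightarrow> real ^ 'k1"
    using pos(2)[OF that] by (intro classN_nonneg[OF zeta(1)]) simp
  have nn_u: "0 \<le> \<zeta>u (\<delta>2u s * norm (u s))" if "0 \<le> s" for s and u :: "real \<Rightarrow> real ^ 'm"
    using pos(3)[OF that] by (intro classN_nonneg[OF zeta(2)]) simp

  \<comment> \<open>The output estimate under hypothesis (A)\<close>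
  {
    assume A
    define b1 where "b1 = the_inv_into {0..} a1"
    have b1: "b1 \<in> Kinf" "\<And>x. 0 \<le> x \<Longrightarrow> b1 (a1 x) = x"
      using Kinf_inverse[OF lower(1)] by (auto simp: b1_def)
    note b1D = KinfD[OF b1(1)]
    show "\<exists>\<sigma>2\<in>KL. \<forall>t0\<ge>0. \<forall>x20\<in>Linf {-r2..0} UNIV.
          \<forall>v2\<in>Linf_loc {0..} S1. \<forall>u\<in>Linf_loc {0..} U. \<forall>d\<in>Linf_loc {0..} D.
          \<forall>x2. is_solution r2 \<tau> f2 t0 x20 v2 u d x2 \<longrightarrow>
            (\<forall>t\<ge>t0. norm (H2 t (hist (r2 - \<tau> t) (t - \<tau> t) x2))
               \<le> \<sigma>2 (\<beta> t0 * supnorm r2 x20) (t - t0)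
                  + (SUP s\<in>{t0..t}. the_inv_into {0..} a1 (\<zeta> (\<delta>2 s * norm (v2 s))))
                  + (SUP s\<in>{t0..t}. the_inv_into {0..} a1 (\<zeta>u (\<delta>2u s * norm (u s)))))"
      unfolding b1_def[symmetric]
    proof (intro bexI[OF _ KL_comp_Kinf[OF sigma(1) a2 b1(1)]] allI ballI impI)
      fix t0 x20 v2 u d x2 t
      assume t0: "0 \<le> t0" and x20: "x20 \<in> Linf {-r2..0} UNIV" and v2: "v2 \<in> Linf_loc {0..} S1"
        and u: "u \<in> Linf_loc {0..} U" and d: "d \<in> Linf_loc {0..} D"
        and sol: "is_solution r2 \<tau> f2 t0 x20 v2 u d x2" and t: "t0 \<le> t"
      define S where "S = \<sigma> (a2 (\<beta> t0 * supnorm r2 x20)) (t - t0)"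
      define Z where "Z = (SUP s\<in>{t0..t}. \<zeta> (\<delta>2 s * norm (v2 s)))"
      define Zu where "Zu = (SUP s\<in>{t0..t}. \<zeta>u (\<delta>2u s * norm (u s)))"
      have "0 \<le> S"
        unfolding S_def
        using supnorm_nonneg[OF x20 r2_nonneg] pos(1)[OF t0] t
        by (intro KL_nonneg[OF sigma(1)] KinfD(5)[OF a2]) auto
      have "0 \<le> Z"
        unfolding Z_def using t0 t by (intro cSUP_upper2[where x = t] bdd_v[OF v2 t0] nn_v) auto
      have "0 \<le> Zu"
        unfolding Zu_def using t0 t by (intro cSUP_upper2[where x = t] bdd_u[OF u t0] nn_u) auto
      \<comment> \<open>Since the delay lies between 0 and \<open>r2\<close>, the output at time
        \<open>t\<close> depends only on the stored history, to which (A) applies.\<close>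
      have "hist (r2 - \<tau> t) (- \<tau> t) (hist r2 t x2) = hist (r2 - \<tau> t) (t - \<tau> t) x2"
        unfolding hist_def restrict_def using tau_bounds[of t] t0 t by (auto simp: fun_eq_iff algebra_simps)
      then have "a1 (norm (H2 t (hist (r2 - \<tau> t) (t - \<tau> t) x2))) \<le> V t (hist r2 t x2)"
        using \<open>A\<close> hist_mem[OF sol t] t0 t unfolding A_def by (metis order_trans)
      also have "\<dots> \<le> max S (max Z Zu)"
        unfolding S_def Z_def Zu_def by (rule V_decay[OF t0 x20 v2 u d sol t])
      finally have "b1 (a1 (norm (H2 t (hist (r2 - \<tau> t) (t - \<tau> t) x2)))) \<le> b1 (max S (max Z Zu))"
        using KinfD(5)[OF lower(1)] \<open>0 \<le> S\<close> by (intro mono_onD[OF b1D(3)]) auto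
      also have "\<dots> = max (b1 S) (max (b1 Z) (b1 Zu))"
        using \<open>0 \<le> S\<close> \<open>0 \<le> Z\<close> \<open>0 \<le> Zu\<close> by (simp add: mono_on_max[OF b1D(3)])
      \<comment> \<open>The claimed estimate is a sum, and all three terms are nonnegative.\<close>
      also have "\<dots> \<le> b1 S + b1 Z + b1 Zu"
        using b1D(5)[OF \<open>0 \<le> S\<close>] b1D(5)[OF \<open>0 \<le> Z\<close>] b1D(5)[OF \<open>0 \<le> Zu\<close>] by simp
      also have "b1 Z = (SUP s\<in>{t0..t}. b1 (\<zeta> (\<delta>2 s * norm (v2 s))))"
        unfolding Z_def using t0 t
        by (intro mono_continuous_SUP[OF b1D(1,3)] bdd_v[OF v2 t0] nn_v) auto
      also have "b1 Zu = (SUP s\<in>{t0..t}. b1 (\<zeta>u (\<delta>2u s * norm (u s))))"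
        unfolding Zu_def using t0 t
        by (intro mono_continuous_SUP[OF b1D(1,3)] bdd_u[OF u t0] nn_u) auto
      finally show "norm (H2 t (hist (r2 - \<tau> t) (t - \<tau> t) x2))
          \<le> b1 (\<sigma> (a2 (\<beta> t0 * supnorm r2 x20)) (t - t0))
            + (SUP s\<in>{t0..t}. b1 (\<zeta> (\<delta>2 s * norm (v2 s))))
            + (SUP s\<in>{t0..t}. b1 (\<zeta>u (\<delta>2u s * norm (u s))))"
        unfolding S_def by (simp add: b1(2))
    qed
  }

  \<comment> \<open>The weighted state estimate under hypothesis (B)\<close>
  assume "B \<and> (\<forall>t\<ge>0. \<delta>2 t = 1)"
  then have B and \<delta>1: "\<And>t. 0 \<le> t \<Longrightarrow> \<delta>2 t = 1"
    by auto
  define b where "b = the_inv_into {0..} p"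
  have bK: "b \<in> Kinf"
    using Kinf_inverse[OF lower(2)] by (simp add: b_def)
  note bD = KinfD[OF bK] and a2D = KinfD[OF a2]
  \<comment> \<open>This is the \<open>q\<close> of \<open>weighted_norm_bound\<close>; its
    compositions with \<open>\<zeta>\<close> and \<open>\<zeta>u\<close> are the gains
    \<open>p2\<close> and \<open>p2u\<close>.\<close>
  define q where "q = (\<lambda>w. (b (2 * w))\<^sup>2)"
  have q_cont: "continuous_on {0..} q"
    unfolding q_def by (intro continuous_intros continuous_on_compose2[OF bD(1)]) auto
  have q_mono: "mono_on {0..} q"
  proof (rule mono_onI)
    fix x y :: real assume "x \<in> {0..}" "y \<in> {0..}" "x \<le> y"
    then show "q x \<le> q y"
      unfolding q_def using bD(5) by (intro power_mono mono_onD[OF bD(3)]) auto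
  qed
  have q0: "q 0 = 0" and q_nonneg: "\<And>w. 0 \<le> q w"
    using bD(4) by (auto simp: q_def)
  have qa_cont: "continuous_on {0..} (\<lambda>x. q (a2 x))"
    by (rule continuous_on_compose2[OF q_cont a2D(1)]) (auto simp: a2D(5))
  have qa_mono: "mono_on {0..} (\<lambda>x. q (a2 x))"
    using a2D(5) by (auto intro!: mono_onI mono_onD[OF q_mono] mono_onD[OF a2D(3)])
  \<comment> \<open>The first summand covers times at which the initial history is still visible,
    the second covers the initial value of \<open>V\<close>.\<close>
  let ?g = "\<lambda>s. s\<^sup>2 + q (a2 (s\<^sup>2))"
  have g: "?g \<in> classN"
    unfolding classN_def using a2D(4) q0
    by (auto intro!: mono_onI add_mono mono_onD[OF qa_mono] power_mono)
  show "\<forall>\<phi>\<in>Kplus. \<exists>\<mu>2\<in>Kplus. \<exists>c2\<in>Kplus. \<exists>g2\<in>classN. \<exists>p2\<in>classN. \<exists>p2u\<in>classN.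
          (\<forall>t0\<ge>0. \<forall>x20\<in>Linf {-r2..0} UNIV.
             \<forall>v2\<in>Linf_loc {0..} S1. \<forall>u\<in>Linf_loc {0..} U. \<forall>d\<in>Linf_loc {0..} D.
             \<forall>x2. is_solution r2 \<tau> f2 t0 x20 v2 u d x2 \<longrightarrow>
               (\<forall>t\<ge>t0. \<phi> t * supnorm r2 (hist r2 t x2)
                  \<le> Max {\<mu>2 (t - t0), c2 t0, g2 (supnorm r2 x20),
                         SUP s\<in>{t0..t}. p2 (norm (v2 s)),
                         SUP s\<in>{t0..t}. p2u (\<delta>2u s * norm (u s))}))
          \<and> (bounded (\<phi> ` {0..}) \<and> (\<exists>L>0. \<forall>t\<ge>0. \<beta> t + 1 / \<mu> t \<le> L)
               \<longrightarrow> bounded (c2 ` {0..}))"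
  proof
    fix \<phi> assume \<phi>: "\<phi> \<in> Kplus"
    \<comment> \<open>The summand 1 forces M \<ge> 1, so that lower powers of \<open>M\<close> are
      bounded by the fourth power.\<close>
    define w where "w = (\<lambda>t. 1 + \<phi> t + \<beta> t + 1 / \<mu> t)"
    have \<phi>_pos: "0 < \<phi> t" if "0 \<le> t" for t
      using \<phi> that by (simp add: Kplus_def)
    have "w \<in> Kplus"
    proof -
      have "continuous_on {0..} w"
        unfolding w_def using \<phi> weights(1) lower(3) pos(4)
        by (intro continuous_intros) (force simp: Kplus_def)+
      then show ?thesis
        unfolding Kplus_def using \<phi>_pos pos by (auto simp: w_def intro!: add_pos_pos)
    qed
    from mono_Kplus_dominating[OF this] obtain M where M: "M \<in> Kplus" "mono_on {0..} M"
      "\<And>t. 0 \<le> t \<Longrightarrow> w t \<le> M t"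
      "\<And>C t. \<forall>s\<ge>0. w s \<le> C \<Longrightarrow> 0 \<le> t \<Longrightarrow> M t \<le> C"
      by blast
    have M_ge: "1 \<le> M t" "\<phi> t \<le> M t" "\<beta> t \<le> M t" "1 / \<mu> t \<le> M t" if "0 \<le> t" for t
      using M(3)[OF that] pos[OF that] \<phi>_pos[OF that] divide_pos_pos[OF zero_less_one pos(4)[OF that]]
      unfolding w_def by linarith+
    \<comment> \<open>The argument 2t comes from separating \<open>t0\<close> and
      \<open>t - t0\<close> inside \<open>M t\<close>; the exponent is that of
      \<open>weighted_norm_bound\<close>.\<close>
    define \<mu>2 where "\<mu>2 = (\<lambda>t. M (2 * t) ^ 4)"
    \<comment> \<open>The summands absorb the \<open>t0\<close> share of \<open>M t\<close>, the
      offset \<open>R\<close>, and the weight \<open>\<beta> t0\<close>. A sum replaces the maximum,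
      which keeps continuity immediate.\<close>
    define c2 where "c2 = (\<lambda>t. M (2 * t) ^ 4 + q R + q (a2 ((M t)\<^sup>2)))"
    have M_cont: "continuous_on {0..} M"
      using M(1) by (simp add: Kplus_def)
    have \<mu>2_cont: "continuous_on {0..} \<mu>2"
      unfolding \<mu>2_def by (intro continuous_intros continuous_on_compose2[OF M_cont]) auto
    have \<mu>2_pos: "0 < \<mu>2 t" if "0 \<le> t" for t
      using M_ge(1)[of "2 * t"] that by (simp add: \<mu>2_def)
    have \<mu>2: "\<mu>2 \<in> Kplus"
      using \<mu>2_cont \<mu>2_pos by (simp add: Kplus_def)
    have c2_eq: "c2 = (\<lambda>t. \<mu>2 t + q R + q (a2 ((M t)\<^sup>2)))"
      by (simp add: c2_def \<mu>2_def)
    have "continuous_on {0..} c2"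
      unfolding c2_eq
      by (intro continuous_intros \<mu>2_cont M_cont continuous_on_compose2[OF qa_cont]) auto
    moreover have "0 < c2 t" if "0 \<le> t" for t
      unfolding c2_eq using \<mu>2_pos[OF that] q_nonneg by (simp add: add_pos_nonneg)
    ultimately have c2: "c2 \<in> Kplus"
      by (simp add: Kplus_def)
    have c2_bounded: "bounded (c2 ` {0..})"
      if bd: "bounded (\<phi> ` {0..}) \<and> (\<exists>L>0. \<forall>t\<ge>0. \<beta> t + 1 / \<mu> t \<le> L)"
    proof -
      obtain L where L: "\<And>t. 0 \<le> t \<Longrightarrow> \<beta> t + 1 / \<mu> t \<le> L"
        using bd by blast
      obtain F where F: "\<And>t. t \<in> {0..} \<Longrightarrow> norm (\<phi> t) \<le> F"
        using bd unfolding bounded_iff by blast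
      have "w t \<le> 1 + F + L" if "0 \<le> t" for t
        using L[OF that] F[of t] that unfolding w_def by simp
      \<comment> \<open>The running supremum inherits the uniform bound on \<open>w\<close>, and
        \<open>c2\<close> is monotone in the values of \<open>M\<close>.\<close>
      then have MC: "M t \<le> 1 + F + L" if "0 \<le> t" for t
        using M(4) that by blast
      have "norm (c2 t) \<le> (1 + F + L) ^ 4 + q R + q (a2 ((1 + F + L)\<^sup>2))" if "t \<in> {0..}" for t
      proof -
        have "0 \<le> t" using that by simp
        have "M (2 * t) ^ 4 \<le> (1 + F + L) ^ 4"
          using MC[of "2 * t"] M_ge(1)[of "2 * t"] \<open>0 \<le> t\<close> by (intro power_mono) auto
        moreover have "q (a2 ((M t)\<^sup>2)) \<le> q (a2 ((1 + F + L)\<^sup>2))"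
          using MC[of t] M_ge(1)[of t] \<open>0 \<le> t\<close> by (intro mono_onD[OF qa_mono] power_mono) auto
        moreover have "0 < c2 t"
          using c2 \<open>0 \<le> t\<close> by (simp add: Kplus_def)
        ultimately show ?thesis
          by (simp add: c2_def)
      qed
      then show ?thesis
        unfolding bounded_iff by blast
    qed
    have estimate: "\<phi> t * supnorm r2 (hist r2 t x2)
                  \<le> Max {\<mu>2 (t - t0), c2 t0, ?g (supnorm r2 x20),
                         SUP s\<in>{t0..t}. q (\<zeta> (norm (v2 s))),
                         SUP s\<in>{t0..t}. q (\<zeta>u (\<delta>2u s * norm (u s)))}"
      if t0: "0 \<le> t0" and x20: "x20 \<in> Linf {-r2..0} UNIV" and v2: "v2 \<in> Linf_loc {0..} S1"
        and u: "u \<in> Linf_loc {0..} U" and d: "d \<in> Linf_loc {0..} D"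
        and sol: "is_solution r2 \<tau> f2 t0 x20 v2 u d x2" and t: "t0 \<le> t" for t0 x20 v2 u d x2 t
    proof -
      define N where "N = supnorm r2 x20"
      define Z where "Z = (SUP s\<in>{t0..t}. \<zeta> (\<delta>2 s * norm (v2 s)))"
      define Zu where "Zu = (SUP s\<in>{t0..t}. \<zeta>u (\<delta>2u s * norm (u s)))"
      have "0 \<le> t" using t0 t by simp
      have "0 \<le> N"
        unfolding N_def by (rule supnorm_nonneg[OF x20 r2_nonneg])
      have "0 \<le> Z"
        unfolding Z_def using t0 t by (intro cSUP_upper2[where x = t] bdd_v[OF v2 t0] nn_v) auto
      have "0 \<le> Zu"
        unfolding Zu_def using t0 t by (intro cSUP_upper2[where x = t] bdd_u[OF u t0] nn_u) auto
      have qZ: "q Z = (SUP s\<in>{t0..t}. q (\<zeta> (norm (v2 s))))"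
      proof -
        have "q Z = (SUP s\<in>{t0..t}. q (\<zeta> (\<delta>2 s * norm (v2 s))))"
          unfolding Z_def using t0 t
          by (intro mono_continuous_SUP[OF q_cont q_mono] bdd_v[OF v2 t0] nn_v) auto
        also have "\<dots> = (SUP s\<in>{t0..t}. q (\<zeta> (norm (v2 s))))"
          using t0 \<delta>1 by (intro SUP_cong) auto
        finally show ?thesis .
      qed
      have qZu: "q Zu = (SUP s\<in>{t0..t}. q (\<zeta>u (\<delta>2u s * norm (u s))))"
        unfolding Zu_def using t0 t
        by (intro mono_continuous_SUP[OF q_cont q_mono] bdd_u[OF u t0] nn_u) auto
      define E where "E = max (\<mu>2 (t - t0)) (max (c2 t0) (max (?g N) (max (q Z) (q Zu))))"
      have MtE: "M t ^ 4 \<le> E"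
      proof -
        \<comment> \<open>One of \<open>t0\<close> and \<open>t - t0\<close> is at least half of
          \<open>t\<close>.\<close>
        have "M t \<le> M (2 * t0) \<or> M t \<le> M (2 * (t - t0))"
          using t0 t mono_onD[OF M(2), of t "2 * t0"] mono_onD[OF M(2), of t "2 * (t - t0)"] by force
        then have "M t ^ 4 \<le> M (2 * t0) ^ 4 \<or> M t ^ 4 \<le> M (2 * (t - t0)) ^ 4"
          using M_ge(1)[OF \<open>0 \<le> t\<close>] by (meson order_trans power_mono zero_le_one)
        moreover have "M (2 * t0) ^ 4 \<le> c2 t0"
          using q_nonneg by (simp add: c2_def)
        ultimately show ?thesis
          unfolding E_def \<mu>2_def by (auto simp: le_max_iff_disj)
      qed
      have \<mu>2_t0: "0 < \<mu>2 t0" by (rule \<mu>2_pos[OF t0])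
      have E_ge: "q R \<le> E" "q (a2 ((M t0)\<^sup>2)) \<le> E" "N\<^sup>2 \<le> E" "q (a2 (N\<^sup>2)) \<le> E" "q Z \<le> E" "q Zu \<le> E"
        unfolding E_def c2_eq using \<mu>2_t0 q_nonneg[of R] q_nonneg[of "a2 ((M t0)\<^sup>2)"]
          q_nonneg[of "a2 (N\<^sup>2)"] by (auto simp: le_max_iff_disj)
      \<comment> \<open>Points of the history up to \<open>t0\<close> belong to the initial data;
        later points are states of the solution, controlled through (B).\<close>
      have pointwise: "\<phi> t * norm (hist r2 t x2 \<theta>) \<le> E" if \<theta>: "\<theta> \<in> {-r2..0}" for \<theta>
      proof (cases "t + \<theta> \<le> t0")
        case True
        have "hist r2 t x2 \<theta> = hist r2 t0 x2 (t + \<theta> - t0)"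
          using \<theta> True t by (simp add: hist_app)
        also have "hist r2 t0 x2 = x20"
          using sol by (simp add: is_solution_def)
        finally have "norm (hist r2 t x2 \<theta>) \<le> N"
          unfolding N_def using norm_le_supnorm[OF x20, of "t + \<theta> - t0"] \<theta> True t by simp
        then have "\<phi> t * norm (hist r2 t x2 \<theta>) \<le> M t * N"
          using M_ge[OF \<open>0 \<le> t\<close>] \<phi>_pos[OF \<open>0 \<le> t\<close>] by (intro mult_mono) auto
        also have "\<dots> \<le> max ((M t)\<^sup>2) (N\<^sup>2)"
          by (rule mult_le_max_power2)
        also have "\<dots> \<le> E"
          using MtE E_ge(3) power_increasing[of 2 4 "M t"] M_ge(1)[OF \<open>0 \<le> t\<close>] by simp
        finally show ?thesis .
      next
        case False
        define s where "s = t + \<theta>"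
        have s: "t0 \<le> s" "s \<le> t" "0 \<le> s"
          using False \<theta> t0 by (auto simp: s_def)
        have "hist r2 s x2 0 = x2 s"
          using r2_nonneg by (simp add: hist_app)
        then have "p (\<mu> s * norm (x2 s)) \<le> V s (hist r2 s x2) + R"
          using \<open>B\<close> hist_mem[OF sol s(1)] s(3) unfolding B_def by metis
        \<comment> \<open>Since \<open>\<sigma>\<close> is non-increasing in time from its initial
          value, the bound is uniform in \<open>s\<close>; the suprema are enlarged from
          \<open>{t0..s}\<close> to \<open>{t0..t}\<close>.\<close>
        also have "V s (hist r2 s x2) \<le> max (a2 (\<beta> t0 * N)) (max Z Zu)"
        proof (rule order_trans[OF V_decay[OF t0 x20 v2 u d sol s(1)]], intro max.mono)
          have nn: "0 \<le> a2 (\<beta> t0 * N)"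
            using pos(1)[OF t0] \<open>0 \<le> N\<close> by (intro a2D(5)) simp
          then show "\<sigma> (a2 (\<beta> t0 * supnorm r2 x20)) (s - t0) \<le> a2 (\<beta> t0 * N)"
            using KL_antimono[OF sigma(1) nn, of 0 "s - t0"] sigma(3) s unfolding N_def by simp
          show "(SUP s\<in>{t0..s}. \<zeta> (\<delta>2 s * norm (v2 s))) \<le> Z"
            unfolding Z_def using s by (intro cSUP_subset_mono bdd_v[OF v2 t0]) auto
          show "(SUP s\<in>{t0..s}. \<zeta>u (\<delta>2u s * norm (u s))) \<le> Zu"
            unfolding Zu_def using s by (intro cSUP_subset_mono bdd_u[OF u t0]) auto
        qed
        finally have le: "p (\<mu> s * norm (x2 s)) \<le> max (a2 (\<beta> t0 * N)) (max Z Zu) + R"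
          by simp
        \<comment> \<open>Monotonicity of \<open>M\<close> moves the weight from the intermediate
          time \<open>s\<close> to \<open>t\<close>.\<close>
        have "1 / \<mu> s \<le> M t"
          using M_ge(4)[OF s(3)] mono_onD[OF M(2), of s t] s by simp
        then have "\<phi> t * norm (x2 s) \<le> max (M t ^ 4) (max (q R)
            (max (max (q (a2 ((M t0)\<^sup>2))) (q (a2 (N\<^sup>2)))) (max (q Z) (q Zu))))"
          unfolding q_def b_def
          using pos(4)[OF s(3)] \<phi>_pos[OF \<open>0 \<le> t\<close>] M_ge(2)[OF \<open>0 \<le> t\<close>] pos(1)[OF t0] M_ge(3)[OF t0]
            \<open>0 \<le> N\<close> \<open>0 \<le> Z\<close> \<open>0 \<le> Zu\<close> lower(4)
          by (intro weighted_norm_bound[OF lower(2) a2 _ _ _ _ _ _ _ _ _ _ _ le]) auto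
        also have "\<dots> \<le> E"
          using MtE E_ge by simp
        finally show ?thesis
          using \<theta> by (simp add: hist_app s_def)
      qed
      \<comment> \<open>Dividing by the positive weight turns the pointwise bounds into a bound on
        the supremum itself.\<close>
      have "supnorm r2 (hist r2 t x2) \<le> E / \<phi> t"
        unfolding supnorm_def
      proof (rule cSUP_least)
        show "{-r2..0} \<noteq> {}"
          using r2_nonneg by simp
        show "norm (hist r2 t x2 \<theta>) \<le> E / \<phi> t" if "\<theta> \<in> {-r2..0}" for \<theta>
          using pointwise[OF that] \<phi>_pos[OF \<open>0 \<le> t\<close>] by (simp add: pos_le_divide_eq mult.commute)
      qed
      then have le_E: "\<phi> t * supnorm r2 (hist r2 t x2) \<le> E"
        using \<phi>_pos[OF \<open>0 \<le> t\<close>] by (simp add: pos_le_divide_eq mult.commute)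
      have "E = Max {\<mu>2 (t - t0), c2 t0, ?g N, q Z, q Zu}"
        unfolding E_def by simp
      with le_E show ?thesis
        unfolding qZ qZu N_def by (rule ord_le_eq_trans)
    qed
    show "\<exists>\<mu>2\<in>Kplus. \<exists>c2\<in>Kplus. \<exists>g2\<in>classN. \<exists>p2\<in>classN. \<exists>p2u\<in>classN.
          (\<forall>t0\<ge>0. \<forall>x20\<in>Linf {-r2..0} UNIV.
             \<forall>v2\<in>Linf_loc {0..} S1. \<forall>u\<in>Linf_loc {0..} U. \<forall>d\<in>Linf_loc {0..} D.
             \<forall>x2. is_solution r2 \<tau> f2 t0 x20 v2 u d x2 \<longrightarrow>
               (\<forall>t\<ge>t0. \<phi> t * supnorm r2 (hist r2 t x2)
                  \<le> Max {\<mu>2 (t - t0), c2 t0, g2 (supnorm r2 x20),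
                         SUP s\<in>{t0..t}. p2 (norm (v2 s)),
                         SUP s\<in>{t0..t}. p2u (\<delta>2u s * norm (u s))}))
          \<and> (bounded (\<phi> ` {0..}) \<and> (\<exists>L>0. \<forall>t\<ge>0. \<beta> t + 1 / \<mu> t \<le> L)
               \<longrightarrow> bounded (c2 ` {0..}))"
      by (rule bexI[OF _ \<mu>2], rule bexI[OF _ c2], rule bexI[OF _ g],
          rule bexI[OF _ classN_comp[OF q_mono q0 zeta(1)]],
          rule bexI[OF _ classN_comp[OF q_mono q0 zeta(2)]])
        (intro conjI allI ballI impI, rule estimate, assumption+, rule c2_bounded, assumption)
  qed
qed

end
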